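(* Let $n\ge 2$, $m\ge 1$ and $d\in\{1,\dots,n-1\}$ be integers. It is possible to solve $d$-election, when participation of all the processes is required, in a fully anonymous system of $n$ processes and $m$ registers where communication is through RMW registers if and only if $\gcd(n,m)\le d$.
   Context: System. There are $n$ asynchronous deterministic processes $p_1,\dots,p_n$ and $m$ shared atomic registers. An execution is an interleaving of atomic steps; in each step one process performs one operation on one register and updates its local state. Processes do not crash: every participating process that has not yet returned keeps taking steps; otherwise the interleaving is arbitrary. Algorithms may depend on $n,m,d$. RMW registers. The operations on a register $X$ are read, write, and $\mathsf{compare\&swap}(X,\mathrm{old},\mathrm{new})$, which atomically does the following: if $X=\mathrm{old}$ it assigns $\mathrm{new}$ to $X$ and returns true, otherwise it leaves $X$ unchanged and returns false. Full anonymity. The processes have no identities, run the same code and have the same initial local state (the subscript $i$ is only an external notation). The memory is anonymous: an adversary chooses, for each process $p_i$, a permutation $f_i$ of $\{1,\dots,m\}$, unknown to all the processes; when $p_i$ uses the name $R[x]$ it accesses the register $R[f_i(x)]$. All registers have the same initial value. $d$-election. Each participating process invokes $\mathsf{elect}()$ (once), which returns either "leader" or "not leader"; a process that returns "leader" is elected. An algorithm solves $d$-election if in every execution, for every choice of the permutations $f_i$, every participating process eventually returns, and at least one and at most $d$ processes are elected. "Participation required" means that only executions in which all $n$ processes participate are considered. *)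

theory Defs
  imports
    Complex_Main
    "HOL-Library.Infinite_Typeclass"
    "HOL-Combinatorics.Permutations"
begin

datatype outcome = Leader | NotLeader

text \<open>
  A local state determines the next operation and, for each possible response, the next local
  state. Register names are local names, to be translated by the permutation of the process.
\<close>

datatype ('s, 'v) instr =
    Return outcome
  | Read nat "'v \<Rightarrow> 's"
  | Write nat 'v 's
  | CompareSwap nat 'v 'v "bool \<Rightarrow> 's"

text \<open>
  All processes run the same algorithm from the same initial local state, and no identifier
  is available to it. The common initial register value is part of the algorithm.
\<close>

record ('s, 'v) algorithm =
  init_state :: 's
  init_val :: 'v
  code :: "'s \<Rightarrow> ('s, 'v) instr"

text \<open>
  The names must lie in \<open>{1..m}\<close>: a permutation of \<open>{1..m}\<close> is the identity elsewhere, so any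
  other name would denote a register on which all processes agree.
\<close>

definition uses_registers :: "nat \<Rightarrow> ('s, 'v) algorithm \<Rightarrow> bool" where
  "uses_registers m A \<longleftrightarrow>
     (\<forall>s. case code A s of
            Return r \<Rightarrow> True
          | Read x g \<Rightarrow> x \<in> {1..m}
          | Write x v t \<Rightarrow> x \<in> {1..m}
          | CompareSwap x old new g \<Rightarrow> x \<in> {1..m})"

text \<open>
  Processes are \<open>1, \<dots>, n\<close> and physical registers are \<open>1, \<dots>, m\<close>; the components of a
  configuration outside these ranges are irrelevant.
\<close>

record ('s, 'v) config =
  loc :: "nat \<Rightarrow> 's"
  mem :: "nat \<Rightarrow> 'v"

definition init_config :: "('s, 'v) algorithm \<Rightarrow> ('s, 'v) config" where
  "init_config A = \<lparr>loc = (\<lambda>p. init_state A), mem = (\<lambda>r. init_val A)\<rparr>"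

definition returned :: "('s, 'v) algorithm \<Rightarrow> nat \<Rightarrow> outcome \<Rightarrow> ('s, 'v) config \<Rightarrow> bool" where
  "returned A p r C \<longleftrightarrow> code A (loc C p) = Return r"

text \<open>
  One atomic step of process \<open>p\<close>, where \<open>f p x\<close> is the physical register that \<open>p\<close> calls \<open>x\<close>.
  Scheduling a process that has returned has no effect.
\<close>

definition step ::
  "('s, 'v) algorithm \<Rightarrow> (nat \<Rightarrow> nat \<Rightarrow> nat) \<Rightarrow> nat \<Rightarrow> ('s, 'v) config \<Rightarrow> ('s, 'v) config" where
  "step A f p C =
     (case code A (loc C p) of
        Return r \<Rightarrow> C
      | Read x g \<Rightarrow> C\<lparr>loc := (loc C)(p := g (mem C (f p x)))\<rparr>
      | Write x v t \<Rightarrow> \<lparr>loc = (loc C)(p := t), mem = (mem C)(f p x := v)\<rparr>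
      | CompareSwap x old new g \<Rightarrow>
          (if mem C (f p x) = old
           then \<lparr>loc = (loc C)(p := g True), mem = (mem C)(f p x := new)\<rparr>
           else C\<lparr>loc := (loc C)(p := g False)\<rparr>))"

primrec run ::
  "('s, 'v) algorithm \<Rightarrow> (nat \<Rightarrow> nat \<Rightarrow> nat) \<Rightarrow> (nat \<Rightarrow> nat) \<Rightarrow> nat \<Rightarrow> ('s, 'v) config" where
  "run A f \<sigma> 0 = init_config A"
| "run A f \<sigma> (Suc k) = step A f (\<sigma> k) (run A f \<sigma> k)"

text \<open>
  An execution with full participation is given by the permutations \<open>f\<close> and a schedule \<open>\<sigma>\<close>
  in which each of the \<open>n\<close> processes keeps being scheduled as long as it has not returned.
  Since steps of returned processes are void, finite executions are covered as well.
\<close>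

definition execution ::
  "nat \<Rightarrow> nat \<Rightarrow> ('s, 'v) algorithm \<Rightarrow> (nat \<Rightarrow> nat \<Rightarrow> nat) \<Rightarrow> (nat \<Rightarrow> nat) \<Rightarrow> bool" where
  "execution n m A f \<sigma> \<longleftrightarrow>
     (\<forall>p\<in>{1..n}. f p permutes {1..m}) \<and>
     (\<forall>k. \<sigma> k \<in> {1..n}) \<and>
     (\<forall>p\<in>{1..n}. \<forall>k. (\<nexists>r. returned A p r (run A f \<sigma> k)) \<longrightarrow> (\<exists>j\<ge>k. \<sigma> j = p))"

definition elected ::
  "nat \<Rightarrow> ('s, 'v) algorithm \<Rightarrow> (nat \<Rightarrow> nat \<Rightarrow> nat) \<Rightarrow> (nat \<Rightarrow> nat) \<Rightarrow> nat set" where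
  "elected n A f \<sigma> = {p \<in> {1..n}. \<exists>k. returned A p Leader (run A f \<sigma> k)}"

definition solves_election :: "nat \<Rightarrow> nat \<Rightarrow> nat \<Rightarrow> ('s, 'v) algorithm \<Rightarrow> bool" where
  "solves_election n m d A \<longleftrightarrow>
     uses_registers m A \<and>
     (\<forall>f \<sigma>. execution n m A f \<sigma> \<longrightarrow>
        (\<forall>p\<in>{1..n}. \<exists>k r. returned A p r (run A f \<sigma> k)) \<and>
        1 \<le> card (elected n A f \<sigma>) \<and> card (elected n A f \<sigma>) \<le> d)"

text \<open>
  Solvability of \<open>d\<close>-election is \<open>\<exists>A. solves_election n m d A\<close>. The types of local states and of
  register values should be of class \<^class>\<open>infinite\<close>: a finite type would bound the memory of
  the processes or the size of the registers.
\<close>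

end

theory Submission
  imports Defs "HOL-Library.Countable" "HOL-Library.Multiset" "HOL-Number_Theory.Cong"
begin

text \<open>
  Let \<open>g = gcd n m\<close>. For the impossibility, cut the processes and the registers into blocks of \<open>g\<close>
  consecutive ones, let the permutation of process \<open>p\<close> rotate every block of registers by
  \<open>(p - 1) mod g\<close>, and schedule the processes in turn. While the processes of one block take
  a step each, they are in the same local state and access the \<open>g\<close> different registers of one
  block, which have the same value. So the configuration stays symmetric, and the set of elected
  processes is a nonempty union of blocks.

  For the converse, all processes start as leaders, and a stage replaces the set of leaders by a
  subset. In a stage the leaders distribute the registers among themselves by \<open>CompareSwap\<close>, and
  those whose registers have the largest total weight stay leaders. In odd stages each register
  has weight \<open>1\<close>, in even stages the weight is the number of processes whose first register it is,
  so the weights sum up to \<open>m\<close> and \<open>n\<close>, respectively. If a stage keeps all \<open>k\<close> leaders, then their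
  shares are equal and \<open>k\<close> divides this sum. Among \<open>n\<close> pairs of an odd and an even stage, at least
  one pair keeps all leaders, since at least one leader always remains; their number then divides
  \<open>g\<close>. Shares are made known by posting them in every register; as all processes participate, one
  can wait until every register contains \<open>n\<close> posts of the current stage.
\<close>

section \<open>One atomic step in a uniform form\<close>

fun target :: "('s, 'v) instr \<Rightarrow> nat option" where
  "target (Return r) = None"
| "target (Read x g) = Some x"
| "target (Write x v t) = Some x"
| "target (CompareSwap x old new g) = Some x"

fun next_state :: "('s, 'v) instr \<Rightarrow> 'v \<Rightarrow> 's" where
  "next_state (Return r) u = undefined"
| "next_state (Read x g) u = g u"
| "next_state (Write x v t) u = t"
| "next_state (CompareSwap x old new g) u = g (u = old)"

fun next_val :: "('s, 'v) instr \<Rightarrow> 'v \<Rightarrow> 'v" where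
  "next_val (Return r) u = u"
| "next_val (Read x g) u = u"
| "next_val (Write x v t) u = v"
| "next_val (CompareSwap x old new g) u = (if u = old then new else u)"

text \<open>Every operation accesses one register, and an operation that leaves the register
  unchanged can be viewed as writing back the value found, so the three kinds of access need no
  separate treatment.\<close>

lemma step_eq:
  "step A f p C =
     (case target (code A (loc C p)) of
        None \<Rightarrow> C
      | Some x \<Rightarrow> \<lparr>loc = (loc C)(p := next_state (code A (loc C p)) (mem C (f p x))),
                   mem = (mem C)(f p x := next_val (code A (loc C p)) (mem C (f p x)))\<rparr>)"
  by (cases "code A (loc C p)") (auto simp: step_def)

lemma uses_registersD:
  "uses_registers m A \<Longrightarrow> target (code A s) = Some x \<Longrightarrow> x \<in> {1..m}"
  unfolding uses_registers_def
  by (cases "code A s") (auto split: instr.splits dest: spec[of _ s])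

lemma returned_step: "returned A p r C \<Longrightarrow> returned A p r (step A f q C)"
  by (auto simp: returned_def step_eq split: option.splits)

lemma returned_mono:
  assumes "returned A p r (run A f \<sigma> k)" and "k \<le> k'"
  shows "returned A p r (run A f \<sigma> k')"
  using assms(2,1) by (induction k' rule: dec_induct) (auto intro: returned_step)

subsection \<open>Impossibility\<close>

definition same_block :: "nat \<Rightarrow> nat \<Rightarrow> nat \<Rightarrow> bool" where
  "same_block g a b \<longleftrightarrow> (a - 1) div g = (b - 1) div g"

definition rotation :: "nat \<Rightarrow> nat \<Rightarrow> nat \<Rightarrow> nat \<Rightarrow> nat" where
  "rotation g m p x =
     (if x \<in> {1..m} then (x - 1) div g * g + (x - 1 + (p - 1)) mod g + 1 else x)"

definition symmetric :: "nat \<Rightarrow> nat \<Rightarrow> nat \<Rightarrow> ('s, 'v) config \<Rightarrow> bool" where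
  "symmetric g n m C \<longleftrightarrow>
     (\<forall>p\<in>{1..n}. \<forall>q\<in>{1..n}. same_block g p q \<longrightarrow> loc C p = loc C q) \<and>
     (\<forall>x\<in>{1..m}. \<forall>y\<in>{1..m}. same_block g x y \<longrightarrow> mem C x = mem C y)"

lemma add_mod_left_cancel:
  fixes a b c g :: nat
  assumes "(c + a) mod g = (c + b) mod g" and "a < g" and "b < g"
  shows "a = b"
proof -
  have "[c + a = c + b] (mod g)" using assms(1) by (simp add: Cong.cong_def)
  hence "[a = b] (mod g)" by (simp add: cong_add_lcancel_nat)
  thus ?thesis using assms(2,3) by (simp add: Cong.cong_def)
qed

lemma rotation_in:
  assumes "g > 0" and "g dvd m" and "x \<in> {1..m}"
  shows "rotation g m p x \<in> {1..m}" and "same_block g (rotation g m p x) x"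
proof -
  obtain k where k: "m = g * k" using assms(2) by (elim dvdE)
  have "(x - 1) div g < k"
    using assms(3) unfolding k by (intro less_mult_imp_div_less) (auto simp: mult.commute)
  hence "(x - 1) div g * g + g \<le> m"
    unfolding k by (metis Suc_leI add.commute mult.commute mult_Suc_right mult_le_mono2)
  moreover have "(x - 1 + (p - 1)) mod g < g" using assms(1) by simp
  ultimately show "rotation g m p x \<in> {1..m}"
    using assms(3) unfolding rotation_def atLeastAtMost_iff by auto
  show "same_block g (rotation g m p x) x"
    using assms(1,3) unfolding rotation_def same_block_def by auto
qed

text \<open>A rotation keeps every block, so the image determines the block of \<open>x\<close>;
  cancelling the shift modulo \<open>g\<close> then determines the position in it.\<close>

lemma rotation_permutes:
  assumes "g > 0" and "g dvd m"
  shows "rotation g m p permutes {1..m}"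
proof (rule bij_imp_permutes)
  have "inj_on (rotation g m p) {1..m}"
  proof (rule inj_onI)
    fix x y assume x: "x \<in> {1..m}" and y: "y \<in> {1..m}" and e: "rotation g m p x = rotation g m p y"
    have b: "(x - 1) div g = (y - 1) div g"
      using rotation_in(2)[OF assms x, of p] rotation_in(2)[OF assms y, of p] e
      unfolding same_block_def by simp
    have "((p - 1) + (x - 1)) mod g = ((p - 1) + (y - 1)) mod g"
      using e x y b unfolding rotation_def by (simp add: add.commute)
    hence "((p - 1) + (x - 1) mod g) mod g = ((p - 1) + (y - 1) mod g) mod g"
      by (simp add: mod_add_right_eq)
    hence "(x - 1) mod g = (y - 1) mod g"
      by (rule add_mod_left_cancel) (use assms(1) in auto)
    hence "x - 1 = y - 1" using b by (metis div_mult_mod_eq)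
    thus "x = y" using x y by auto
  qed
  moreover have "rotation g m p ` {1..m} = {1..m}"
    by (rule endo_inj_surj) (use rotation_in(1)[OF assms] calculation in auto)
  ultimately show "bij_betw (rotation g m p) {1..m} {1..m}"
    by (simp add: bij_betw_def)
qed (auto simp: rotation_def)

text \<open>A round consists of the \<open>g\<close> steps from \<open>g * i\<close> on and
  schedules one block of processes. They start from the same state, hence execute the same
  instruction with the same name. Their shifts are distinct modulo \<open>g\<close>, so each finds
  its register still untouched in this round, and all of them read the same value.\<close>

lemma block_step:
  fixes A :: "('s, 'v) algorithm"
  assumes A: "uses_registers m A" and g: "g > 0" and gm: "g dvd m" and gn: "g dvd n"
    and sym: "symmetric g n m (run A (rotation g m) (\<lambda>k. k mod n + 1) (g * i))" and n: "n > 0"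
  shows "symmetric g n m (run A (rotation g m) (\<lambda>k. k mod n + 1) (g * Suc i))"
proof -
  let ?f = "rotation g m"
  let ?R = "run A ?f (\<lambda>k. k mod n + 1)"
  define C where "C = ?R (g * i)"
  \<comment> \<open>The round schedules the processes \<open>b + 1, ..., b + g\<close>, and process
    \<open>b + j + 1\<close> moves at time \<open>g * i + j\<close>.\<close>
  define b where "b = (g * i) mod n"
  obtain l where l: "n = g * l" using gn by (elim dvdE)
  have lpos: "l > 0" using n l by auto
  have b: "b = g * (i mod l)" unfolding b_def l by (rule mult_mod_right[symmetric])
  have bn: "b + g \<le> n" unfolding b l using lpos
    by (metis Suc_leI mod_less_divisor mult_Suc_right add.commute mult_le_mono2)
  have sched: "(g * i + j) mod n = b + j" if "j < g" for j
  proof -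
    have "(g * i + j) mod n = (b + j) mod n" unfolding b_def by (simp add: mod_add_left_eq)
    thus ?thesis using that bn by simp
  qed
  have bmod: "(b + j) mod g = j" "(b + j) div g = i mod l" if "j < g" for j
    using that g unfolding b by simp_all
  have locC: "loc C (b + j + 1) = loc C (b + 1)" if "j < g" for j
  proof -
    have "same_block g (b + j + 1) (b + 1)"
      using bmod[OF that] bmod[of 0] g unfolding same_block_def by simp
    thus ?thesis using sym that bn unfolding C_def symmetric_def by auto
  qed
  have locC': "loc C p = loc C (b + 1)" if "p \<in> {1..n}" "(p - 1) div g = i mod l" for p
  proof -
    have "same_block g p (b + 1)"
      using bmod[of 0] g that unfolding same_block_def by simp
    moreover have "b + 1 \<in> {1..n}" using bn g by auto
    ultimately show ?thesis using sym that unfolding C_def symmetric_def by blast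
  qed
  let ?I = "code A (loc C (b + 1))"
  show ?thesis
  proof (cases "target ?I")
    case None
    \<comment> \<open>Here the whole block has returned, and the round has no effect.\<close>
    have "j \<le> g \<Longrightarrow> ?R (g * i + j) = C" for j
    proof (induction j)
      case 0 show ?case by (simp add: C_def)
    next
      case (Suc j)
      hence "?R (g * i + j) = C" and "j < g" by auto
      thus ?case using locC[of j] None by (simp add: step_eq sched)
    qed
    hence "?R (g * Suc i) = C" by (simp add: add.commute)
    thus ?thesis using sym by (simp add: C_def)
  next
    case (Some x)
    have x: "x \<in> {1..m}" using uses_registersD[OF A Some] .
    let ?r = "\<lambda>j. ?f (b + j + 1) x"
    have r_in: "?r j \<in> {1..m}" "same_block g (?r j) x" for j
      using rotation_in[OF g gm x] by auto
    have r_inj: "j = j'" if "?r j = ?r j'" "j < g" "j' < g" for j j'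
    proof -
      have "(x - 1 + b + j) mod g = (x - 1 + b + j') mod g"
        using that(1) x unfolding rotation_def by (auto simp: add.assoc)
      thus ?thesis using add_mod_left_cancel that by blast
    qed
    define u where "u = mem C x"
    have memC: "mem C (?r j) = u" for j
      using sym r_in[of j] x unfolding u_def C_def symmetric_def by blast
    define s' where "s' = next_state ?I u"
    define u' where "u' = next_val ?I u"
    \<comment> \<open>After \<open>j\<close> steps of the round, exactly the first \<open>j\<close>
      processes of the block and the registers they accessed are updated.\<close>
    have inv: "j \<le> g \<Longrightarrow>
       loc (?R (g * i + j)) = (\<lambda>p. if p \<in> {b + 1..b + j} then s' else loc C p) \<and>
       mem (?R (g * i + j)) = (\<lambda>r. if r \<in> ?r ` {..<j} then u' else mem C r)" for j
    proof (induction j)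
      case 0 show ?case by (simp add: C_def)
    next
      case (Suc j)
      let ?D = "?R (g * i + j)"
      have j: "j < g" using Suc by simp
      have IH: "loc ?D = (\<lambda>p. if p \<in> {b + 1..b + j} then s' else loc C p)"
        "mem ?D = (\<lambda>r. if r \<in> ?r ` {..<j} then u' else mem C r)"
        using Suc by auto
      have l1: "loc ?D (b + j + 1) = loc C (b + 1)" using IH(1) locC[OF j] by simp
      have m1: "mem ?D (?r j) = u"
      proof -
        have "?r j \<notin> ?r ` {..<j}" using r_inj j by fastforce
        thus ?thesis using IH(2) memC by simp
      qed
      have "?R (g * i + Suc j) = step A ?f (b + j + 1) ?D" by (simp add: sched[OF j])
      also have "\<dots> = \<lparr>loc = (loc ?D)(b + j + 1 := s'), mem = (mem ?D)(?r j := u')\<rparr>"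
        unfolding step_eq l1 Some option.case m1 s'_def u'_def ..
      finally have E: "?R (g * i + Suc j) = \<dots>" .
      show ?case unfolding E config.simps IH
        by (intro conjI ext) (auto simp: lessThan_Suc)
    qed
    let ?E = "?R (g * Suc i)"
    have E: "loc ?E = (\<lambda>p. if p \<in> {b + 1..b + g} then s' else loc C p)"
      "mem ?E = (\<lambda>r. if r \<in> ?r ` {..<g} then u' else mem C r)"
      using inv[of g] by (simp_all add: add.commute)
    have blk: "p \<in> {b + 1..b + g} \<longleftrightarrow> (p - 1) div g = i mod l" if "p \<ge> 1" for p
    proof
      assume "p \<in> {b + 1..b + g}"
      then obtain j where "p = b + j + 1" "j < g"
        by (auto intro!: that[of "p - b - 1"])
      thus "(p - 1) div g = i mod l" using bmod by simp
    next
      assume "(p - 1) div g = i mod l"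
      hence "p - 1 = b + (p - 1) mod g" unfolding b by (metis mult_div_mod_eq)
      moreover have "(p - 1) mod g < g" using g by simp
      ultimately show "p \<in> {b + 1..b + g}" using that unfolding atLeastAtMost_iff by linarith
    qed
    have rblk: "r \<in> ?r ` {..<g} \<longleftrightarrow> same_block g r x" if "r \<in> {1..m}" for r
    proof
      assume "same_block g r x"
      \<comment> \<open>The converse inclusion is by counting: the \<open>g\<close> accessed
        registers are distinct and lie in the block of \<open>x\<close>, which has at most
        \<open>g\<close> elements.\<close>
      have "inj_on ?r {..<g}" using r_inj by (auto intro: inj_onI)
      hence c: "card (?r ` {..<g}) = g" by (simp add: card_image)
      let ?B = "{r \<in> {1..m}. same_block g r x}"
      have "?B \<subseteq> (\<lambda>j. (x - 1) div g * g + j + 1) ` {..<g}"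
      proof
        fix y assume "y \<in> ?B"
        hence "y - 1 = (x - 1) div g * g + (y - 1) mod g" and "y \<ge> 1"
          unfolding same_block_def by (auto simp: div_mult_mod_eq) (metis div_mult_mod_eq)
        thus "y \<in> (\<lambda>j. (x - 1) div g * g + j + 1) ` {..<g}"
          using g by (intro image_eqI[of _ _ "(y - 1) mod g"]) auto
      qed
      from surj_card_le[OF finite_lessThan this] have "card ?B \<le> g" by simp
      moreover have "?r ` {..<g} \<subseteq> ?B" using r_in by auto
      ultimately have "?r ` {..<g} = ?B"
        using c by (intro card_seteq) auto
      thus "r \<in> ?r ` {..<g}" using that \<open>same_block g r x\<close> by blast
    qed (use r_in in auto)
    show ?thesis unfolding symmetric_def E
    proof (intro conjI ballI impI)
      fix p q assume *: "p \<in> {1..n}" "q \<in> {1..n}" "same_block g p q"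
      have "p \<in> {b + 1..b + g} \<longleftrightarrow> q \<in> {b + 1..b + g}"
        using * blk[of p] blk[of q] unfolding same_block_def by simp
      moreover have "loc C p = loc C q" using sym * unfolding C_def symmetric_def by blast
      ultimately show "(if p \<in> {b + 1..b + g} then s' else loc C p) = (if q \<in> {b + 1..b + g} then s' else loc C q)" by presburger
    next
      fix y z assume *: "y \<in> {1..m}" "z \<in> {1..m}" "same_block g y z"
      have "y \<in> ?r ` {..<g} \<longleftrightarrow> z \<in> ?r ` {..<g}"
        using * rblk[of y] rblk[of z] unfolding same_block_def by simp
      moreover have "mem C y = mem C z" using sym * unfolding C_def symmetric_def by blast
      ultimately show "(if y \<in> ?r ` {..<g} then u' else mem C y) = (if z \<in> ?r ` {..<g} then u' else mem C z)" by presburger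
    qed
  qed
qed

theorem election_impossible:
  fixes A :: "('s, 'v) algorithm"
  assumes A: "solves_election n m d A" and n: "n > 0"
  shows "gcd n m \<le> d"
proof -
  define g where "g = gcd n m"
  have g: "g > 0" "g dvd m" "g dvd n" using n by (auto simp: g_def)
  let ?f = "rotation g m"
  let ?s = "\<lambda>k. k mod n + 1"
  let ?R = "run A ?f ?s"
  have ex: "execution n m A ?f ?s"
    unfolding execution_def
  proof (intro conjI ballI allI impI)
    fix p k assume p: "p \<in> {1..n}"
    then obtain q where q: "p = q + 1" "q < n" by (auto intro: that[of "p - 1"])
    have "k * n + q \<ge> k" using n by (simp add: trans_le_add1)
    moreover have "?s (k * n + q) = p" using q by simp
    ultimately show "\<exists>j\<ge>k. ?s j = p" by blast
  next
    fix k show "?s k \<in> {1..n}" using n by (simp add: Suc_leI)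
  qed (use g rotation_permutes in auto)
  have A': "uses_registers m A" using A by (simp add: solves_election_def)
  have sym: "symmetric g n m (?R (g * i))" for i
  proof (induction i)
    case 0 show ?case by (simp add: symmetric_def init_config_def)
  next
    case (Suc i) thus ?case using block_step[OF A' g] n by blast
  qed
  let ?E = "elected n A ?f ?s"
  have card: "1 \<le> card ?E" "card ?E \<le> d" using A ex unfolding solves_election_def by blast+
  then obtain p where "p \<in> ?E" by (metis card.empty ex_in_conv not_one_le_zero)
  then obtain k where p: "p \<in> {1..n}" and "returned A p Leader (?R k)"
    unfolding elected_def by blast
  \<comment> \<open>Symmetry is only known between rounds; since a result is kept, one may pass from
    \<open>k\<close> to the later round boundary \<open>g * k\<close>.\<close>
  moreover have "k \<le> g * k" using g by simp
  ultimately have ret: "returned A p Leader (?R (g * k))" using returned_mono by metis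
  let ?B = "(\<lambda>j. (p - 1) div g * g + j + 1) ` {..<g}"
  have "?B \<subseteq> ?E"
  proof
    fix q assume "q \<in> ?B"
    then obtain j where j: "j < g" "q = (p - 1) div g * g + j + 1" by auto
    have blk: "same_block g q p" using j g unfolding same_block_def by simp
    obtain l where l: "n = g * l" using g by (elim dvdE)
    have "(p - 1) div g < l"
      using p unfolding l by (intro less_mult_imp_div_less) (auto simp: mult.commute)
    hence "(p - 1) div g * g + g \<le> n"
      unfolding l by (metis Suc_leI add.commute mult.commute mult_Suc_right mult_le_mono2)
    hence q: "q \<in> {1..n}" using j by auto
    have "loc (?R (g * k)) q = loc (?R (g * k)) p"
      using sym[of k] blk p q unfolding symmetric_def by blast
    hence "returned A q Leader (?R (g * k))" using ret by (simp add: returned_def)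
    thus "q \<in> ?E" using q unfolding elected_def by blast
  qed
  moreover have "card ?B = g" by (subst card_image) (auto intro: inj_onI)
  moreover have "finite ?E" by (simp add: elected_def)
  ultimately have "g \<le> card ?E" by (metis card_mono)
  thus ?thesis using card by (simp add: g_def)
qed

subsection \<open>Change of state and value types\<close>

fun lift_instr :: "('s \<Rightarrow> 't) \<Rightarrow> ('v \<Rightarrow> 'w) \<Rightarrow> ('s, 'v) instr \<Rightarrow> ('t, 'w) instr" where
  "lift_instr i j (Return r) = Return r"
| "lift_instr i j (Read x g) = Read x (\<lambda>w. i (g (inv j w)))"
| "lift_instr i j (Write x v t) = Write x (j v) (i t)"
| "lift_instr i j (CompareSwap x old new g) = CompareSwap x (j old) (j new) (\<lambda>b. i (g b))"

text \<open>States outside \<open>range i\<close> are never reached; they return so that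
  \<open>uses_registers\<close> holds for them too.\<close>

definition lift_algorithm ::
  "('s \<Rightarrow> 't) \<Rightarrow> ('v \<Rightarrow> 'w) \<Rightarrow> ('s, 'v) algorithm \<Rightarrow> ('t, 'w) algorithm" where
  "lift_algorithm i j A =
     \<lparr>init_state = i (init_state A), init_val = j (init_val A),
      code = (\<lambda>s. if s \<in> range i then lift_instr i j (code A (inv i s)) else Return NotLeader)\<rparr>"

lemma code_lift: "inj i \<Longrightarrow> code (lift_algorithm i j A) (i s) = lift_instr i j (code A s)"
  by (simp add: lift_algorithm_def)

text \<open>Injectivity of \<open>j\<close> preserves the outcome of every comparison in
  \<open>CompareSwap\<close> and lets \<open>inv j\<close> recover the value read.\<close>

lemma run_lift:
  assumes i: "inj i" and j: "inj j"
  shows "run (lift_algorithm i j A) f \<sigma> k =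
           \<lparr>loc = i \<circ> loc (run A f \<sigma> k), mem = j \<circ> mem (run A f \<sigma> k)\<rparr>"
proof (induction k)
  case 0 show ?case by (simp add: init_config_def lift_algorithm_def comp_def)
next
  case (Suc k)
  have "target (lift_instr i j I) = target I" for I :: "('a, 'c) instr" by (cases I) auto
  moreover have "next_state (lift_instr i j I) (j u) = i (next_state I u)"
    if "target I \<noteq> None" for I u using that i j by (cases I) (auto simp: inj_eq)
  moreover have "next_val (lift_instr i j I) (j u) = j (next_val I u)" for I u
    using i j by (cases I) (auto simp: inj_eq)
  ultimately show ?case
    by (auto simp: Suc step_eq code_lift[OF i] fun_eq_iff split: option.splits)
qed

lemma lift_solves:
  assumes i: "inj i" and j: "inj j" and A: "solves_election n m d A"
  shows "solves_election n m d (lift_algorithm i j A)"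
proof -
  let ?A = "lift_algorithm i j A"
  have ret: "returned ?A p r (run ?A f \<sigma> k) \<longleftrightarrow> returned A p r (run A f \<sigma> k)" for p r f \<sigma> k
    by (cases "code A (loc (run A f \<sigma> k) p)")
      (simp_all add: returned_def run_lift[OF i j] code_lift[OF i])
  have "uses_registers m ?A" unfolding uses_registers_def
  proof
    fix s
    show "case code ?A s of Return r \<Rightarrow> True | Read x g \<Rightarrow> x \<in> {1..m} | Write x v t \<Rightarrow> x \<in> {1..m}
        | CompareSwap x old new g \<Rightarrow> x \<in> {1..m}"
    proof (cases "s \<in> range i")
      case True
      then obtain t where t: "s = i t" by blast
      have "uses_registers m A" using A by (simp add: solves_election_def)
      from uses_registersD[OF this, of t] show ?thesis unfolding t code_lift[OF i]
        by (cases "code A t") auto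
    qed (simp add: lift_algorithm_def)
  qed
  thus ?thesis
    using A unfolding solves_election_def execution_def elected_def ret by blast
qed

lemma ex_inj_infinite: "\<exists>i :: 'a::countable \<Rightarrow> 'b::infinite. inj i"
proof -
  obtain e :: "nat \<Rightarrow> 'b" where "inj e"
    using infinite_countable_subset[OF infinite_UNIV] by blast
  hence "inj (e \<circ> (to_nat :: 'a \<Rightarrow> nat))" by (intro inj_compose) auto
  thus ?thesis by blast
qed

subsection \<open>Successive sets of leaders\<close>

text \<open>The counting argument, detached from the algorithm: \<open>S p t\<close> is the share of
  \<open>p\<close> in stage \<open>t\<close>, and \<open>Ld t\<close> consists of the leaders after
  it. A pair of stages either loses a leader or forces the number of leaders to divide both
  \<open>m\<close> and \<open>n\<close>; since some process always attains the maximum,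
  \<open>n\<close> losses are impossible.\<close>

lemma leader_sets_bound:
  fixes S :: "nat \<Rightarrow> nat \<Rightarrow> nat"
  assumes n: "n > 0" and m: "m > 0"
    and zero: "\<And>p. p \<in> {1..n} \<Longrightarrow> S p 0 = 0"
    and others: "\<And>p t. p \<in> {1..n} \<Longrightarrow> t < 2 * n \<Longrightarrow> \<not> (\<forall>q\<in>{1..n}. S q t \<le> S p t) \<Longrightarrow> S p (Suc t) = 0"
    and total: "\<And>t. t < 2 * n \<Longrightarrow> (\<Sum>p\<in>{1..n}. S p (Suc t)) = (if even t then m else n)"
  defines "Ld \<equiv> \<lambda>t. {p \<in> {1..n}. \<forall>q\<in>{1..n}. S q t \<le> S p t}"
  shows "1 \<le> card (Ld (2 * n))" and "card (Ld (2 * n)) \<le> gcd n m"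
proof -
  have fin: "finite (Ld t)" for t by (simp add: Ld_def)
  have max: "\<exists>p\<in>{1..n}. \<forall>q\<in>{1..n}. S q t \<le> S p t" for t
  proof -
    have "Max ((\<lambda>q. S q t) ` {1..n}) \<in> (\<lambda>q. S q t) ` {1..n}" using n by (intro Max_in) auto
    then obtain p where "p \<in> {1..n}" "S p t = Max ((\<lambda>q. S q t) ` {1..n})" by auto
    thus ?thesis by (intro bexI[of _ p]) auto
  qed
  have ne: "card (Ld t) \<ge> 1" for t
  proof -
    have "Ld t \<noteq> {}" using max[of t] by (auto simp: Ld_def)
    thus ?thesis using fin[of t] by (simp add: Suc_le_eq card_gt_0_iff)
  qed
  thus "1 \<le> card (Ld (2 * n))" by blast
  have sub: "Ld (Suc t) \<subseteq> Ld t" if t: "t < 2 * n" for t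
  proof
    fix p assume p: "p \<in> Ld (Suc t)"
    \<comment> \<open>A maximal share of \<open>0\<close> would make all shares \<open>0\<close>,
      against the positive total.\<close>
    have "S p (Suc t) \<noteq> 0"
    proof
      assume "S p (Suc t) = 0"
      hence "(\<Sum>q\<in>{1..n}. S q (Suc t)) = 0" using p by (auto simp: Ld_def)
      thus False using total[OF t] n m by (auto split: if_splits)
    qed
    thus "p \<in> Ld t" using others[of p t] p t by (auto simp: Ld_def)
  qed
  have dvd: "card (Ld t) dvd (if even t then m else n)"
    if t: "t < 2 * n" and eq: "card (Ld (Suc t)) = card (Ld t)" for t
  proof -
    have E: "Ld (Suc t) = Ld t" using sub[OF t] eq fin by (intro card_subset_eq) auto
    obtain p where p: "p \<in> {1..n}" "\<forall>q\<in>{1..n}. S q (Suc t) \<le> S p (Suc t)" using max by blast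
    \<comment> \<open>The others contribute \<open>0\<close>, and as no leader is lost, all leaders
      have the maximal share.\<close>
    have "(\<Sum>q\<in>{1..n}. S q (Suc t)) = (\<Sum>q\<in>Ld t. S q (Suc t))"
      by (rule sum.mono_neutral_right) (use others[OF _ t] in \<open>auto simp: Ld_def\<close>)
    also have "\<dots> = (\<Sum>q\<in>Ld t. S p (Suc t))"
    proof (rule sum.cong)
      fix q assume "q \<in> Ld t"
      hence "q \<in> Ld (Suc t)" using E by simp
      thus "S q (Suc t) = S p (Suc t)" using p by (intro le_antisym) (auto simp: Ld_def)
    qed simp
    finally have "(if even t then m else n) = card (Ld t) * S p (Suc t)" using total[OF t] by simp
    thus ?thesis by (rule dvdI)
  qed
  \<comment> \<open>Every pair of stages without divisibility costs a leader. For
    \<open>j = n\<close> the second alternative would leave no leader.\<close>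
  have "card (Ld (2 * j)) \<le> gcd n m \<or> card (Ld (2 * j)) + j \<le> n" if "j \<le> n" for j
    using that
  proof (induction j)
    case 0
    have "card (Ld 0) \<le> card {1..n}" by (rule card_mono) (auto simp: Ld_def)
    thus ?case by simp
  next
    case (Suc j)
    have j: "2 * j < 2 * n" "Suc (2 * j) < 2 * n" using Suc.prems by auto
    have le: "card (Ld (Suc (2 * j))) \<le> card (Ld (2 * j))"
      "card (Ld (Suc (Suc (2 * j)))) \<le> card (Ld (Suc (2 * j)))"
      using sub[OF j(1)] sub[OF j(2)] fin by (auto intro: card_mono)
    show ?case
    proof (cases "card (Ld (Suc (Suc (2 * j)))) = card (Ld (2 * j))")
      case True
      hence "card (Ld (Suc (2 * j))) = card (Ld (2 * j))"
        "card (Ld (Suc (Suc (2 * j)))) = card (Ld (Suc (2 * j)))" using le by auto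
      from dvd[OF j(1) this(1)] dvd[OF j(2) this(2)]
      have "card (Ld (2 * Suc j)) dvd gcd n m" using True le by simp
      thus ?thesis using n by (auto intro: dvd_imp_le)
    next
      case False
      thus ?thesis using le Suc by auto
    qed
  qed
  from this[of n] show "card (Ld (2 * n)) \<le> gcd n m" using ne[of "2 * n"] by auto
qed

subsection \<open>The election algorithm\<close>

text \<open>
  A register holds the stages in which it has been captured and the list of posts. A post
  \<open>(t, c, x)\<close> announces the share \<open>c\<close> that its author obtained in stage \<open>t\<close>; \<open>x\<close> is the author's
  local name of the register. Since everyone posts in every register, the posts of stage \<open>0\<close>
  with \<open>x = 1\<close> put exactly \<open>n\<close> marks in the memory.
\<close>

type_synonym register = "nat list \<times> (nat \<times> nat \<times> nat) list"

text \<open>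
  The list \<open>h\<close> holds the shares of the process in the stages \<open>0, 1, \<dots>\<close>, and \<open>x\<close> is the local name
  of the current register. A value \<open>Some v\<close> is the last one read there, to be used by the next
  \<open>CompareSwap\<close>. While capturing, \<open>c\<close> is the share collected so far in stage \<open>length h\<close>.
\<close>

datatype state =
    Capturing "nat list" nat nat "register option"
  | Posting "nat list" nat "register option"
  | Waiting "nat list" nat
  | Finished "nat list" bool

instance state :: countable by countable_datatype

definition marks :: "register \<Rightarrow> nat" where
  "marks v = length (filter (\<lambda>(t, c, x). t = 0 \<and> x = 1) (snd v))"

definition stage_posts :: "nat \<Rightarrow> register \<Rightarrow> nat" where
  "stage_posts s v = length (filter (\<lambda>(t, c, x). t = s) (snd v))"

definition weight :: "nat \<Rightarrow> register \<Rightarrow> nat" where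
  "weight t v = (if odd t then 1 else marks v)"

text \<open>\<open>last h\<close> is the share in stage \<open>length h - 1\<close>, so only posts
  of that stage are compared.\<close>

definition dominates :: "nat list \<Rightarrow> register \<Rightarrow> bool" where
  "dominates h v \<longleftrightarrow> (\<forall>(t, c, x)\<in>set (snd v). Suc t = length h \<longrightarrow> c \<le> last h)"

definition after_capture :: "nat \<Rightarrow> nat list \<Rightarrow> nat \<Rightarrow> nat \<Rightarrow> state" where
  "after_capture m h x c =
     (if x < m then Capturing h (Suc x) c None else Posting (h @ [c]) 1 None)"

definition after_post :: "nat \<Rightarrow> nat list \<Rightarrow> nat \<Rightarrow> state" where
  "after_post m h x = (if x < m then Posting h (Suc x) None else Waiting h 1)"

text \<open>As everyone posts in every register, the posts in the last one decide. A process that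
  lost skips the captures but still posts the share \<open>0\<close>, because the others wait for
  its posts. The history starts with the dummy share of stage \<open>0\<close> and is complete after
  stage \<open>2 * n\<close>.\<close>

definition after_wait :: "nat \<Rightarrow> nat \<Rightarrow> nat list \<Rightarrow> nat \<Rightarrow> register \<Rightarrow> state" where
  "after_wait n m h x v =
     (if x < m then Waiting h (Suc x)
      else if length h = Suc (2 * n) then Finished h (dominates h v)
      else if dominates h v then Capturing h 1 0 None
      else Posting (h @ [0]) 1 None)"

text \<open>Each update depends only on the value that \<open>CompareSwap\<close> compares with, so
  a success acts as one atomic update: no post is lost, and no register is captured twice in a
  stage.\<close>

fun election_code :: "nat \<Rightarrow> nat \<Rightarrow> state \<Rightarrow> (state, register) instr" where
  "election_code n m (Capturing h x c None) = Read x (\<lambda>v.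
     if length h \<in> set (fst v) then after_capture m h x c else Capturing h x c (Some v))"
| "election_code n m (Capturing h x c (Some v)) =
     CompareSwap x v (length h # fst v, snd v) (\<lambda>b.
       if b then after_capture m h x (c + weight (length h) v) else Capturing h x c None)"
| "election_code n m (Posting h x None) = Read x (\<lambda>v. Posting h x (Some v))"
| "election_code n m (Posting h x (Some v)) =
     CompareSwap x v (fst v, (length h - 1, last h, x) # snd v) (\<lambda>b.
       if b then after_post m h x else Posting h x None)"
| "election_code n m (Waiting h x) = Read x (\<lambda>v.
     if stage_posts (length h - 1) v < n then Waiting h x else after_wait n m h x v)"
| "election_code n m (Finished h b) = Return (if b then Leader else NotLeader)"

text \<open>The test for \<open>{1..m}\<close> makes \<open>uses_registers\<close> hold in all
  states; it never fails in well-formed ones. All processes begin by posting the share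
  \<open>0\<close> of stage \<open>0\<close>.\<close>

definition election_algorithm :: "nat \<Rightarrow> nat \<Rightarrow> (state, register) algorithm" where
  "election_algorithm n m =
     \<lparr>init_state = Posting [0] 1 None, init_val = ([], []),
      code = (\<lambda>s. case target (election_code n m s) of
                None \<Rightarrow> election_code n m s
              | Some x \<Rightarrow> if x \<in> {1..m} then election_code n m s else Return NotLeader)\<rparr>"

section \<open>Transitions, and what a local state records\<close>

inductive move :: "nat \<Rightarrow> nat \<Rightarrow> state \<Rightarrow> nat \<Rightarrow> register \<Rightarrow> state \<Rightarrow> register \<Rightarrow> bool"
  for n m :: nat where
  capture_skip: "length h \<in> set (fst v) \<Longrightarrow>
    move n m (Capturing h x c None) x v (after_capture m h x c) v"
| capture_read: "length h \<notin> set (fst v) \<Longrightarrow>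
    move n m (Capturing h x c None) x v (Capturing h x c (Some v)) v"
| capture_win: "move n m (Capturing h x c (Some v)) x v
    (after_capture m h x (c + weight (length h) v)) (length h # fst v, snd v)"
| capture_fail: "u \<noteq> v \<Longrightarrow> move n m (Capturing h x c (Some u)) x v (Capturing h x c None) v"
| post_read: "move n m (Posting h x None) x v (Posting h x (Some v)) v"
| post_win: "move n m (Posting h x (Some v)) x v
    (after_post m h x) (fst v, (length h - 1, last h, x) # snd v)"
| post_fail: "u \<noteq> v \<Longrightarrow> move n m (Posting h x (Some u)) x v (Posting h x None) v"
| wait_stay: "stage_posts (length h - 1) v < n \<Longrightarrow> move n m (Waiting h x) x v (Waiting h x) v"
| wait_pass: "\<not> stage_posts (length h - 1) v < n \<Longrightarrow>
    move n m (Waiting h x) x v (after_wait n m h x v) v"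

fun hist :: "state \<Rightarrow> nat list" where
  "hist (Capturing h x c ov) = h"
| "hist (Posting h x ov) = h"
| "hist (Waiting h x) = h"
| "hist (Finished h b) = h"

text \<open>Stages not yet reached count as \<open>0\<close>, so that the totals are meaningful at
  every moment.\<close>

fun share :: "state \<Rightarrow> nat \<Rightarrow> nat" where
  "share (Capturing h x c ov) t = (if t < length h then h ! t else if t = length h then c else 0)"
| "share s t = (if t < length (hist s) then hist s ! t else 0)"

text \<open>Posts are made in the order of local names, hence in the current stage exactly those
  below \<open>y\<close> are done.\<close>

fun posted :: "state \<Rightarrow> nat \<Rightarrow> nat \<Rightarrow> bool" where
  "posted (Posting h y ov) t x \<longleftrightarrow> t < length h \<and> (Suc t = length h \<longrightarrow> x < y)"
| "posted s t x \<longleftrightarrow> t < length (hist s)"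

text \<open>\<open>seen s t x\<close>: the process knows that all posts of stage \<open>t\<close> in register \<open>x\<close> are present.\<close>

fun seen :: "state \<Rightarrow> nat \<Rightarrow> nat \<Rightarrow> bool" where
  "seen (Waiting h y) t x \<longleftrightarrow> Suc t < length h \<or> Suc t = length h \<and> x < y"
| "seen (Posting h y ov) t x \<longleftrightarrow> Suc t < length h"
| "seen s t x \<longleftrightarrow> t < length (hist s)"

fun well_formed :: "nat \<Rightarrow> nat \<Rightarrow> state \<Rightarrow> bool" where
  "well_formed n m (Capturing h x c ov) \<longleftrightarrow> x \<in> {1..m} \<and> length h \<in> {1..2 * n} \<and>
     (\<forall>v. ov = Some v \<longrightarrow> length h \<notin> set (fst v)) \<and> h ! 0 = 0"
| "well_formed n m (Posting h x ov) \<longleftrightarrow> x \<in> {1..m} \<and> length h \<in> {1..Suc (2 * n)} \<and> h ! 0 = 0"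
| "well_formed n m (Waiting h x) \<longleftrightarrow> x \<in> {1..m} \<and> length h \<in> {1..Suc (2 * n)} \<and> h ! 0 = 0"
| "well_formed n m (Finished h b) \<longleftrightarrow> length h = Suc (2 * n) \<and> h ! 0 = 0"

lemma target_code_finished: "target (election_code n m s) = None \<longleftrightarrow> (\<exists>h b. s = Finished h b)"
  by (cases "(n, m, s)" rule: election_code.cases) auto

lemma move_code:
  assumes "target (election_code n m s) = Some x"
  shows "move n m s x v (next_state (election_code n m s) v) (next_val (election_code n m s) v)"
  using assms
  by (cases "(n, m, s)" rule: election_code.cases) (auto simp del: One_nat_def intro: move.intros)

lemma target_code_in:
  "well_formed n m s \<Longrightarrow> target (election_code n m s) = Some x \<Longrightarrow> x \<in> {1..m}"
  by (cases "(n, m, s)" rule: election_code.cases) auto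

lemma election_algorithm_code:
  "well_formed n m s \<Longrightarrow> code (election_algorithm n m) s = election_code n m s"
  using target_code_in[of n m s] by (auto simp: election_algorithm_def split: option.splits)

lemmas after_defs = after_capture_def after_post_def after_wait_def

lemma well_formed_move:
  "move n m s x v s' v' \<Longrightarrow> well_formed n m s \<Longrightarrow> well_formed n m s'"
  by (cases rule: move.cases) (auto simp: after_defs nth_append)

lemma hist_move:
  assumes "move n m s x v s' v'"
  shows "length (hist s) \<le> length (hist s')" and "t < length (hist s) \<Longrightarrow> hist s' ! t = hist s ! t"
  using assms by (cases rule: move.cases; auto simp: after_defs nth_append)+

lemma posted_length: "posted s t x \<Longrightarrow> t < length (hist s)"
  by (cases s) auto

lemma share_hist: "t < length (hist s) \<Longrightarrow> share s t = hist s ! t"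
  by (cases s) auto

text \<open>A stored \<open>Some v\<close> with \<open>v\<close> the present content of the register
  is exactly the situation in which the pending \<open>CompareSwap\<close> succeeds. It marks a
  successful post here, and a successful capture in \<open>share_move\<close> and
  \<open>fst_move\<close>.\<close>

lemma posted_move:
  assumes "move n m s x v s' v'" and "well_formed n m s" and "z \<in> {1..m}"
  shows "posted s' t z \<longleftrightarrow> posted s t z \<or>
           (\<exists>h. s = Posting h x (Some v) \<and> Suc t = length h \<and> z = x)"
  using assms by (cases rule: move.cases) (auto simp: after_defs)

lemma snd_move:
  assumes "move n m s x v s' v'"
  shows "snd v' = snd v \<and> (\<nexists>h. s = Posting h x (Some v)) \<or>
    (\<exists>h. s = Posting h x (Some v) \<and> snd v' = (length h - 1, last h, x) # snd v)"
  using assms by (cases rule: move.cases) auto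

lemma seen_move:
  assumes "move n m s x v s' v'" and "well_formed n m s" and "y \<in> {1..m}"
  shows "seen s' t y \<longleftrightarrow> seen s t y \<or>
    (\<exists>h. s = Waiting h x \<and> length h = Suc t \<and> n \<le> stage_posts t v \<and> y = x)"
proof -
  have "seen s' t y \<longleftrightarrow> seen s t y \<or>
      (\<exists>h. s = Waiting h x \<and> n \<le> stage_posts (length h - 1) v \<and> Suc t = length h \<and> y = x)"
    using assms by (cases rule: move.cases) (auto simp: after_defs not_less)
  thus ?thesis by (metis diff_Suc_1)
qed

lemma share_move:
  assumes "move n m s x v s' v'" and "well_formed n m s"
  shows "share s' t = share s t + (if \<exists>h c. s = Capturing h x c (Some v) \<and> t = length h then weight t v else 0)"
  using assms by (cases rule: move.cases) (auto simp: after_defs nth_append)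

lemma fst_move:
  assumes "move n m s x v s' v'"
  shows "set (fst v') = set (fst v) \<union> {t. \<exists>h c. s = Capturing h x c (Some v) \<and> t = length h}"
  using assms by (cases rule: move.cases) auto

subsection \<open>The invariant of the algorithm\<close>

text \<open>\<open>P t\<close> stands for leading in stage \<open>t\<close>. Keeping it abstract
  reduces the preservation of \<open>inv_leads\<close> to one process; the last hypothesis covers
  the moment when the process leaves its last register and decides whether it leads.\<close>

lemma leads_move:
  assumes "move n m s x v s' v'" and "well_formed n m s"
    and "\<And>h y c ov t. s = Capturing h y c ov \<Longrightarrow> length h = Suc t \<Longrightarrow> P t"
    and "\<And>h b. s = Finished h b \<Longrightarrow> b = P (2 * n)"
    and "\<And>t. Suc t < length (hist s) \<Longrightarrow> \<not> P t \<Longrightarrow> hist s ! Suc t = 0"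
    and "\<And>h t. s = Waiting h x \<Longrightarrow> \<not> x < m \<Longrightarrow> length h = Suc t \<Longrightarrow> n \<le> stage_posts t v \<Longrightarrow>
           dominates h v = P t"
  shows "(\<forall>h y c ov t. s' = Capturing h y c ov \<longrightarrow> length h = Suc t \<longrightarrow> P t) \<and>
    (\<forall>h b. s' = Finished h b \<longrightarrow> b = P (2 * n)) \<and>
    (\<forall>t. Suc t < length (hist s') \<longrightarrow> \<not> P t \<longrightarrow> hist s' ! Suc t = 0)"
  using assms
  by (cases rule: move.cases)
    (auto simp: after_defs nth_append not_less less_Suc_eq eq_commute[of "Suc _" "length _"] split: if_splits)

text \<open>\<open>K t y\<close> stands for the register with local name \<open>y\<close> being
  captured in stage \<open>t\<close>. A capturing process leaves a register only after it is
  captured, by itself or by another process, so a leader completes the stage with all registers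
  captured.\<close>

lemma captured_move:
  assumes "move n m s x v s' v'" and "well_formed n m s"
    and "\<forall>h z c ov. s = Capturing h z c ov \<longrightarrow> (\<forall>y\<in>{1..<z}. K (length h) y)"
    and "\<And>h c ov. s = Capturing h x c ov \<Longrightarrow> length h \<in> set (fst v') \<Longrightarrow> K (length h) x"
    and "\<And>t y. Suc t < length (hist s) \<Longrightarrow> P t \<Longrightarrow> y \<in> {1..m} \<Longrightarrow> K (Suc t) y"
    and "\<And>h t. s = Waiting h x \<Longrightarrow> \<not> x < m \<Longrightarrow> length h = Suc t \<Longrightarrow> n \<le> stage_posts t v \<Longrightarrow>
           dominates h v = P t"
  shows "(\<forall>h z c ov. s' = Capturing h z c ov \<longrightarrow> (\<forall>y\<in>{1..<z}. K (length h) y)) \<and>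
    (\<forall>t. Suc t < length (hist s') \<longrightarrow> P t \<longrightarrow> (\<forall>y\<in>{1..m}. K (Suc t) y))"
  using assms
  by (cases rule: move.cases)
    (auto simp: after_defs nth_append not_less less_Suc_eq le_less[of _ x] eq_commute[of "Suc _" "length _"]
      split: if_splits)

definition leads :: "nat \<Rightarrow> (nat \<Rightarrow> state) \<Rightarrow> nat \<Rightarrow> nat \<Rightarrow> bool" where
  "leads n L p t \<longleftrightarrow> (\<forall>q\<in>{1..n}. share (L q) t \<le> share (L p) t)"

text \<open>The posts that register \<open>r\<close> ought to contain, together with their authors,
  which the register itself does not reveal.\<close>

definition posts :: "nat \<Rightarrow> nat \<Rightarrow> (nat \<Rightarrow> nat \<Rightarrow> nat) \<Rightarrow> (nat \<Rightarrow> state) \<Rightarrow> nat \<Rightarrow> (nat \<times> nat \<times> nat) set" where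
  "posts n m f L r = {(q, t, x). q \<in> {1..n} \<and> x \<in> {1..m} \<and> f q x = r \<and> posted (L q) t x}"

definition content :: "(nat \<Rightarrow> state) \<Rightarrow> nat \<times> nat \<times> nat \<Rightarrow> nat \<times> nat \<times> nat" where
  "content L = (\<lambda>(q, t, x). (t, share (L q) t, x))"

text \<open>The weight as fixed by the permutations; the algorithm only has the marks found in the
  register.\<close>

definition true_weight :: "nat \<Rightarrow> (nat \<Rightarrow> nat \<Rightarrow> nat) \<Rightarrow> nat \<Rightarrow> nat \<Rightarrow> nat" where
  "true_weight n f t r = (if odd t then 1 else card {p \<in> {1..n}. f p 1 = r})"

locale permuted =
  fixes n m :: nat and f :: "nat \<Rightarrow> nat \<Rightarrow> nat"
  assumes n: "n > 0" and m: "m > 0"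
    and perm: "\<And>p. p \<in> {1..n} \<Longrightarrow> f p permutes {1..m}"
begin

lemma f_in: "p \<in> {1..n} \<Longrightarrow> x \<in> {1..m} \<Longrightarrow> f p x \<in> {1..m}"
  using perm permutes_in_image by metis

lemma f_inj: "p \<in> {1..n} \<Longrightarrow> f p x = f p y \<Longrightarrow> x = y"
  using perm permutes_inj injD by metis

lemma f_surj:
  assumes "p \<in> {1..n}" and "r \<in> {1..m}"
  obtains x where "x \<in> {1..m}" and "f p x = r"
  using permutes_image[OF perm[OF assms(1)]] assms(2) by (metis imageE)

lemma sum_true_weight:
  "(\<Sum>r\<in>{1..m}. true_weight n f t r) = (if odd t then m else n)"
proof (cases "odd t")
  case False
  have "(\<Sum>r\<in>{1..m}. card {p \<in> {1..n}. f p 1 = r}) = card (\<Union>r\<in>{1..m}. {p \<in> {1..n}. f p 1 = r})"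
    by (rule card_UN_disjoint[symmetric]) auto
  also have "(\<Union>r\<in>{1..m}. {p \<in> {1..n}. f p 1 = r}) = {1..n}"
    using f_in[of _ 1] m by auto
  finally show ?thesis using False by (simp add: true_weight_def)
qed (simp add: true_weight_def)

lemma finite_posts: "finite (posts n m f L r)"
proof (rule finite_subset)
  show "posts n m f L r \<subseteq> (SIGMA q:{1..n}. {..<length (hist (L q))} \<times> {1..m})"
    by (auto simp: posts_def posted_length)
qed auto

text \<open>Different processes may write equal posts, so multiplicities matter, while the order
  depends on the schedule.\<close>

definition inv_posts :: "(nat \<Rightarrow> state) \<Rightarrow> (nat \<Rightarrow> register) \<Rightarrow> bool" where
  "inv_posts L M \<longleftrightarrow> (\<forall>r\<in>{1..m}. mset (snd (M r)) = image_mset (content L) (mset_set (posts n m f L r)))"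

definition inv_seen :: "(nat \<Rightarrow> state) \<Rightarrow> bool" where
  "inv_seen L \<longleftrightarrow> (\<forall>p\<in>{1..n}. \<forall>q\<in>{1..n}. \<forall>t. \<forall>y\<in>{1..m}. \<forall>z\<in>{1..m}.
     seen (L p) t y \<longrightarrow> f p y = f q z \<longrightarrow> posted (L q) t z)"

definition inv_leads :: "(nat \<Rightarrow> state) \<Rightarrow> bool" where
  "inv_leads L \<longleftrightarrow> (\<forall>p\<in>{1..n}.
     (\<forall>h x c ov t. L p = Capturing h x c ov \<longrightarrow> length h = Suc t \<longrightarrow> leads n L p t) \<and>
     (\<forall>h b. L p = Finished h b \<longrightarrow> b = leads n L p (2 * n)) \<and>
     (\<forall>t. Suc t < length (hist (L p)) \<longrightarrow> \<not> leads n L p t \<longrightarrow> hist (L p) ! Suc t = 0))"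

definition inv_captured :: "(nat \<Rightarrow> state) \<Rightarrow> (nat \<Rightarrow> register) \<Rightarrow> bool" where
  "inv_captured L M \<longleftrightarrow> (\<forall>p\<in>{1..n}.
     (\<forall>h x c ov. L p = Capturing h x c ov \<longrightarrow> (\<forall>y\<in>{1..<x}. length h \<in> set (fst (M (f p y))))) \<and>
     (\<forall>t. Suc t < length (hist (L p)) \<longrightarrow> leads n L p t \<longrightarrow> (\<forall>r\<in>{1..m}. Suc t \<in> set (fst (M r)))))"

text \<open>This holds also in the middle of a stage: a register counts from the moment of its
  capture.\<close>

definition inv_total :: "(nat \<Rightarrow> state) \<Rightarrow> (nat \<Rightarrow> register) \<Rightarrow> bool" where
  "inv_total L M \<longleftrightarrow> (\<forall>t\<ge>1. (\<Sum>p\<in>{1..n}. share (L p) t) =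
     (\<Sum>r\<in>{r\<in>{1..m}. t \<in> set (fst (M r))}. true_weight n f t r))"

definition invariant :: "(nat \<Rightarrow> state) \<Rightarrow> (nat \<Rightarrow> register) \<Rightarrow> bool" where
  "invariant L M \<longleftrightarrow> (\<forall>p\<in>{1..n}. well_formed n m (L p)) \<and>
     inv_posts L M \<and> inv_seen L \<and> inv_leads L \<and> inv_captured L M \<and> inv_total L M"

lemma invariant_init: "invariant (\<lambda>p. Posting [0] 1 None) (\<lambda>r. ([], []))"
proof -
  have "posts n m f (\<lambda>p. Posting [0] 1 None) r = {}" for r
    by (auto simp: posts_def)
  thus ?thesis using m
    by (auto simp: invariant_def inv_posts_def inv_seen_def inv_leads_def inv_captured_def inv_total_def)
qed

lemma filter_posts:
  assumes "inv_posts L M" and "r \<in> {1..m}"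
  shows "length (filter Q (snd (M r))) = card {z \<in> posts n m f L r. Q (content L z)}"
proof -
  have "length (filter Q (snd (M r))) = size (filter_mset Q (mset (snd (M r))))"
    by (metis mset_filter size_mset)
  also have "\<dots> = size (filter_mset (\<lambda>z. Q (content L z)) (mset_set (posts n m f L r)))"
    using assms by (simp add: inv_posts_def filter_mset_image_mset comp_def)
  also have "\<dots> = card {z \<in> posts n m f L r. Q (content L z)}"
    by (simp add: finite_posts)
  finally show ?thesis .
qed

lemma set_posts:
  assumes "inv_posts L M" and "r \<in> {1..m}"
  shows "set (snd (M r)) = content L ` posts n m f L r"
proof -
  have "set (snd (M r)) = set_mset (mset (snd (M r)))" by simp
  thus ?thesis using assms finite_posts by (simp add: inv_posts_def del: set_mset_mset)
qed

text \<open>Since \<open>f q\<close> is injective, a process has at most one post per stage in a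
  physical register. Hence \<open>n\<close> posts of a stage have \<open>n\<close> different
  authors, although the posts are anonymous.\<close>

lemma stage_posts_complete:
  assumes "inv_posts L M" and r: "r \<in> {1..m}" and full: "n \<le> stage_posts t (M r)"
    and q: "q \<in> {1..n}" and z: "z \<in> {1..m}" "f q z = r"
  shows "posted (L q) t z"
proof -
  let ?A = "{z \<in> posts n m f L r. (\<lambda>(s, c, x). s = t) (content L z)}"
  have "inj_on fst ?A"
  proof (rule inj_onI)
    fix a b assume "a \<in> ?A" "b \<in> ?A" "fst a = fst b"
    moreover obtain q s y q' s' y' where "a = (q, s, y)" "b = (q', s', y')"
      by (metis prod_cases3)
    ultimately show "a = b" using f_inj[of q y y'] by (auto simp: posts_def content_def)
  qed
  moreover have "card ?A \<ge> n" using full filter_posts[OF assms(1) r] by (simp add: stage_posts_def)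
  ultimately have "card (fst ` ?A) \<ge> n" by (simp add: card_image)
  moreover have "fst ` ?A \<subseteq> {1..n}" by (auto simp: posts_def)
  ultimately have "fst ` ?A = {1..n}" by (intro card_seteq) auto
  then obtain a where a: "a \<in> ?A" "q = fst a" using q by (metis (no_types, lifting) imageE)
  then obtain x where "x \<in> {1..m}" "f q x = r" "posted (L q) t x"
    by (auto simp: posts_def content_def)
  moreover from this have "x = z" using f_inj[OF q] z by simp
  ultimately show ?thesis by simp
qed

lemma stage_posts_full:
  assumes "inv_posts L M" and r: "r \<in> {1..m}"
    and all: "\<And>q z. q \<in> {1..n} \<Longrightarrow> z \<in> {1..m} \<Longrightarrow> f q z = r \<Longrightarrow> posted (L q) t z"
  shows "n \<le> stage_posts t (M r)"
proof -
  let ?A = "{z \<in> posts n m f L r. (\<lambda>(s, c, x). s = t) (content L z)}"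
  have "{1..n} \<subseteq> fst ` ?A"
  proof
    fix q assume q: "q \<in> {1..n}"
    obtain z where "z \<in> {1..m}" "f q z = r" using f_surj[OF q r] .
    hence "(q, t, z) \<in> ?A" using all q by (auto simp: posts_def content_def)
    thus "q \<in> fst ` ?A" by force
  qed
  hence "n \<le> card ?A" using surj_card_le[of ?A "{1..n}" fst] finite_posts by simp
  thus ?thesis using filter_posts[OF assms(1) r] by (simp add: stage_posts_def)
qed

text \<open>Once everyone who calls \<open>r\<close> by the name \<open>1\<close> has posted there
  in stage \<open>0\<close>, the marks count exactly these processes.\<close>

lemma weight_eq:
  assumes "inv_posts L M" and r: "r \<in> {1..m}"
    and all: "\<And>q. q \<in> {1..n} \<Longrightarrow> f q 1 = r \<Longrightarrow> posted (L q) 0 1"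
  shows "weight t (M r) = true_weight n f t r"
proof -
  have "marks (M r) = card {z \<in> posts n m f L r. (\<lambda>(s, c, x). s = 0 \<and> x = 1) (content L z)}"
    unfolding marks_def by (rule filter_posts[OF assms(1) r])
  also have "{z \<in> posts n m f L r. (\<lambda>(s, c, x). s = 0 \<and> x = 1) (content L z)} =
      (\<lambda>q. (q, 0, 1)) ` {p \<in> {1..n}. f p 1 = r}"
    using all m by (auto simp: posts_def content_def)
  also have "card \<dots> = card {p \<in> {1..n}. f p 1 = r}"
    by (rule card_image) (auto intro: inj_onI)
  finally show ?thesis by (simp add: weight_def true_weight_def)
qed

section \<open>Preservation of the invariant under one move\<close>

context
  fixes L M p x s' v'
  assumes inv: "invariant L M" and p: "p \<in> {1..n}" and x: "x \<in> {1..m}"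
    and mv: "move n m (L p) x (M (f p x)) s' v'"
begin

definition "L' = L(p := s')"
definition "M' = M(f p x := v')"

lemma L'_simps: "L' p = s'" "q \<noteq> p \<Longrightarrow> L' q = L q"
  by (auto simp: L'_def)

lemma wf: "q \<in> {1..n} \<Longrightarrow> well_formed n m (L q)"
  using inv by (simp add: invariant_def)

lemma wf': "q \<in> {1..n} \<Longrightarrow> well_formed n m (L' q)"
  using wf well_formed_move[OF mv] p by (cases "q = p") (auto simp: L'_simps)

lemma r_in: "f p x \<in> {1..m}"
  using f_in p x .

lemma posted_L':
  assumes "q \<in> {1..n}" and "z \<in> {1..m}"
  shows "posted (L' q) t z \<longleftrightarrow> posted (L q) t z \<or>
     (\<exists>h. L p = Posting h x (Some (M (f p x))) \<and> q = p \<and> Suc t = length h \<and> z = x)"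
  using posted_move[OF mv wf[OF p] assms(2)] assms by (cases "q = p") (auto simp: L'_simps)

lemma posted_mono: "q \<in> {1..n} \<Longrightarrow> z \<in> {1..m} \<Longrightarrow> posted (L q) t z \<Longrightarrow> posted (L' q) t z"
  using posted_L' by blast

lemma hist_L': "t < length (hist (L q)) \<Longrightarrow> t < length (hist (L' q)) \<and> hist (L' q) ! t = hist (L q) ! t"
  using hist_move[OF mv] by (cases "q = p") (auto simp: L'_simps)

lemma share_L': "t < length (hist (L q)) \<Longrightarrow> share (L' q) t = share (L q) t"
  using hist_L'[of t q] by (simp add: share_hist)

lemma posts_L':
  "posts n m f L' r = posts n m f L r \<union>
     {(p, t, x) | t h. L p = Posting h x (Some (M (f p x))) \<and> Suc t = length h \<and> r = f p x}"
  using p x unfolding posts_def by (auto simp: posted_L')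

text \<open>Only shares of completed stages are posted, and these never change.\<close>

lemma content_L': "z \<in> posts n m f L r \<Longrightarrow> content L' z = content L z"
  by (auto simp: posts_def content_def intro!: share_L' dest: posted_length)

lemma inv_posts': "inv_posts L' M'"
  unfolding inv_posts_def
proof
  fix r assume r: "r \<in> {1..m}"
  have old: "mset (snd (M r)) = image_mset (content L) (mset_set (posts n m f L r))"
    using inv r by (simp add: invariant_def inv_posts_def)
  also have "\<dots> = image_mset (content L') (mset_set (posts n m f L r))"
    by (rule image_mset_cong) (simp add: content_L' finite_posts)
  finally have old': "mset (snd (M r)) = image_mset (content L') (mset_set (posts n m f L r))" .
  show "mset (snd (M' r)) = image_mset (content L') (mset_set (posts n m f L' r))"
  proof (cases "\<exists>h. L p = Posting h x (Some (M (f p x))) \<and> r = f p x")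
    case False
    hence "posts n m f L' r = posts n m f L r" unfolding posts_L' by auto
    moreover have "snd (M' r) = snd (M r)" using False snd_move[OF mv] by (auto simp: M'_def)
    ultimately show ?thesis using old' by simp
  next
    case True
    then obtain h where h: "L p = Posting h x (Some (M (f p x)))" "r = f p x" by blast
    have len: "length h \<ge> 1" using wf[OF p] h by simp
    have "snd (M' r) = (length h - 1, last h, x) # snd (M r)"
      using h snd_move[OF mv] by (auto simp: M'_def)
    moreover have "content L' (p, length h - 1, x) = (length h - 1, last h, x)"
      using share_L'[of "length h - 1" p] h len
      by (auto simp: content_def last_conv_nth Suc_le_eq)
    moreover have "posts n m f L' r = insert (p, length h - 1, x) (posts n m f L r)"
      unfolding posts_L' using h len by auto
    moreover have "(p, length h - 1, x) \<notin> posts n m f L r"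
      using h len by (auto simp: posts_def)
    ultimately show ?thesis using old' by (simp add: finite_posts)
  qed
qed

lemma seen_posted:
  assumes "q \<in> {1..n}" and "r \<in> {1..n}" and "y \<in> {1..m}" and "z \<in> {1..m}"
    and "seen (L q) t y" and "f q y = f r z"
  shows "posted (L r) t z"
  using inv assms unfolding invariant_def inv_seen_def by blast

lemma inv_seen': "inv_seen L'"
  unfolding inv_seen_def
proof (intro ballI allI impI)
  fix q r t y z
  assume q: "q \<in> {1..n}" and r: "r \<in> {1..n}" and y: "y \<in> {1..m}" and z: "z \<in> {1..m}"
    and s: "seen (L' q) t y" and e: "f q y = f r z"
  show "posted (L' r) t z"
  proof (cases "seen (L q) t y")
    case True
    thus ?thesis using seen_posted[OF q r y z _ e] posted_mono[OF r z] by blast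
  next
    case False
    hence "q = p" using s by (metis L'_simps(2))
    with False s have h: "n \<le> stage_posts t (M (f p x))" "y = x"
      using seen_move[OF mv wf[OF p] y] by (auto simp: L'_simps)
    have "inv_posts L M" using inv by (simp add: invariant_def)
    from stage_posts_complete[OF this r_in h(1) r z] e h(2) \<open>q = p\<close>
    have "posted (L r) t z" by simp
    thus ?thesis using posted_mono[OF r z] by blast
  qed
qed

text \<open>\<open>seen\<close> is downward closed in the register, so the last register stands for all of them.\<close>

lemma seen_last_posted:
  assumes "q \<in> {1..n}" and "r \<in> {1..n}" and "z \<in> {1..m}" and "seen (L q) t m"
  shows "posted (L r) t z"
proof -
  obtain y where y: "y \<in> {1..m}" "f q y = f r z" using f_surj f_in assms by metis
  moreover have "seen (L q) t y" using assms(4) y by (cases "L q") auto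
  ultimately show ?thesis using seen_posted assms by blast
qed

lemma seen_last_length:
  assumes "q \<in> {1..n}" and "r \<in> {1..n}" and "seen (L q) t m"
  shows "t < length (hist (L r))"
  using seen_last_posted[OF assms(1,2) _ assms(3), of 1] m posted_length by auto

text \<open>If a process has seen stage \<open>t\<close> complete, everyone has posted its share in
  it, so the comparison of these shares is final.\<close>

lemma leads_L':
  assumes "q \<in> {1..n}" and "seen (L q) t m"
  shows "leads n L' q t \<longleftrightarrow> leads n L q t"
  using seen_last_length[OF assms(1) _ assms(2)] assms(1) by (simp add: leads_def share_L')

lemma inv_total': "inv_total L' M'"
  unfolding inv_total_def
proof (intro allI impI)
  fix t :: nat assume t: "t \<ge> 1"
  let ?C = "\<lambda>M. {r \<in> {1..m}. t \<in> set (fst (M r))}"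
  have old: "(\<Sum>q\<in>{1..n}. share (L q) t) = (\<Sum>r\<in>?C M. true_weight n f t r)"
    using inv t by (simp add: invariant_def inv_total_def)
  have split: "(\<Sum>q\<in>{1..n}. g q) = g p + (\<Sum>q\<in>{1..n} - {p}. g q)" for g :: "nat \<Rightarrow> nat"
    using p by (simp add: sum.remove)
  have rest: "(\<Sum>q\<in>{1..n} - {p}. share (L' q) t) = (\<Sum>q\<in>{1..n} - {p}. share (L q) t)"
    by (rule sum.cong) (auto simp: L'_simps)
  show "(\<Sum>q\<in>{1..n}. share (L' q) t) = (\<Sum>r\<in>?C M'. true_weight n f t r)"
  proof (cases "\<exists>h c. L p = Capturing h x c (Some (M (f p x))) \<and> t = length h")
    case False
    hence "share (L' p) t = share (L p) t"
      using share_move[OF mv wf[OF p], of t] by (auto simp: L'_simps)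
    moreover have "?C M' = ?C M" using fst_move[OF mv] False by (auto simp: M'_def)
    ultimately show ?thesis using old rest split[of "\<lambda>q. share (L' q) t"] split[of "\<lambda>q. share (L q) t"]
      by simp
  next
    case True
    then obtain h c where h: "L p = Capturing h x c (Some (M (f p x)))" "t = length h" by blast
    \<comment> \<open>Well-formedness of a pending capture: the register has not been counted for
      stage \<open>t\<close> before.\<close>
    have notin: "t \<notin> set (fst (M (f p x)))" using wf[OF p] h by simp
    \<comment> \<open>Captures begin in stage \<open>1\<close>, when all posts of stage
      \<open>0\<close> are present; so the marks already have their final number.\<close>
    have "seen (L p) 0 m" using h t by auto
    hence "posted (L q) 0 1" if "q \<in> {1..n}" for q
      using seen_last_posted[OF p that, of 1] m by simp
    hence w: "weight t (M (f p x)) = true_weight n f t (f p x)"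
      using inv r_in by (intro weight_eq) (auto simp: invariant_def)
    have "share (L' p) t = share (L p) t + true_weight n f t (f p x)"
      using share_move[OF mv wf[OF p], of t] h w by (auto simp: L'_simps)
    moreover have "?C M' = insert (f p x) (?C M)"
      using fst_move[OF mv] h r_in by (auto simp: M'_def)
    moreover have "f p x \<notin> ?C M" using notin by simp
    ultimately show ?thesis
      using old rest split[of "\<lambda>q. share (L' q) t"] split[of "\<lambda>q. share (L q) t"] by simp
  qed
qed

lemma captured_mono: "t \<in> set (fst (M r)) \<Longrightarrow> t \<in> set (fst (M' r))"
  using fst_move[OF mv] by (auto simp: M'_def)

lemma seen_of_length:
  assumes "q \<in> {1..n}" and "Suc t < length (hist (L q))"
  shows "seen (L q) t m"
  using assms(2) by (cases "L q") auto

lemma seen_capturing: "L q = Capturing h y c ov \<Longrightarrow> length h = Suc t \<Longrightarrow> seen (L q) t m"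
  by auto

lemma seen_finished: "L q = Finished h b \<Longrightarrow> q \<in> {1..n} \<Longrightarrow> seen (L q) (2 * n) m"
  using wf[of q] by auto

text \<open>A full register contains the post of every process for stage \<open>t\<close>, with its
  true share, so comparing with the posts amounts to comparing with all processes.\<close>

lemma dominates_leads:
  assumes h: "L p = Waiting h x" and len: "length h = Suc t" and full: "n \<le> stage_posts t (M (f p x))"
  shows "dominates h (M (f p x)) \<longleftrightarrow> leads n L' p t"
proof -
  have ip: "inv_posts L M" using inv by (simp add: invariant_def)
  have S: "set (snd (M (f p x))) = content L ` posts n m f L (f p x)"
    by (rule set_posts[OF ip r_in])
  have last: "share (L p) t = last h" using h len by (cases h rule: rev_cases) auto
  have all: "\<exists>z. (q, t, z) \<in> posts n m f L (f p x)" if q: "q \<in> {1..n}" for q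
  proof -
    obtain z where z: "z \<in> {1..m}" "f q z = f p x" using f_surj[OF q r_in] .
    thus ?thesis using stage_posts_complete[OF ip r_in full q z] q by (auto simp: posts_def)
  qed
  have "dominates h (M (f p x)) \<longleftrightarrow> (\<forall>q\<in>{1..n}. share (L q) t \<le> last h)"
  proof
    assume D: "dominates h (M (f p x))"
    show "\<forall>q\<in>{1..n}. share (L q) t \<le> last h"
    proof
      fix q assume "q \<in> {1..n}"
      from all[OF this] obtain z where "(q, t, z) \<in> posts n m f L (f p x)" ..
      hence "content L (q, t, z) \<in> set (snd (M (f p x)))" unfolding S by (rule imageI)
      thus "share (L q) t \<le> last h" using D len by (auto simp: dominates_def content_def)
    qed
  next
    assume "\<forall>q\<in>{1..n}. share (L q) t \<le> last h"
    thus "dominates h (M (f p x))" unfolding dominates_def S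
using len by (auto simp: posts_def content_def)
  qed
  also have "\<dots> \<longleftrightarrow> leads n L p t" by (simp only: leads_def last)
  also have "\<dots> \<longleftrightarrow> leads n L' p t"
  proof -
    have "t < length (hist (L q))" if "q \<in> {1..n}" for q
      using all[OF that] by (auto simp: posts_def dest: posted_length)
    thus ?thesis using p by (simp add: leads_def share_L')
  qed
  finally show ?thesis .
qed

lemma inv_leads': "inv_leads L'"
  unfolding inv_leads_def
proof
  fix q assume q: "q \<in> {1..n}"
  \<comment> \<open>Each clause concerns a stage that \<open>q\<close> has seen complete, hence
    leading means the same in \<open>L\<close> and \<open>L'\<close>.\<close>
  have old: "\<And>h y c ov t. L q = Capturing h y c ov \<Longrightarrow> length h = Suc t \<Longrightarrow> leads n L' q t"
    "\<And>h b. L q = Finished h b \<Longrightarrow> b = leads n L' q (2 * n)"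
    "\<And>t. Suc t < length (hist (L q)) \<Longrightarrow> \<not> leads n L' q t \<Longrightarrow> hist (L q) ! Suc t = 0"
    using inv q leads_L'[OF q] seen_capturing seen_finished[OF _ q] seen_of_length[OF q]
    unfolding invariant_def inv_leads_def by metis+
  show "(\<forall>h y c ov t. L' q = Capturing h y c ov \<longrightarrow> length h = Suc t \<longrightarrow> leads n L' q t) \<and>
     (\<forall>h b. L' q = Finished h b \<longrightarrow> b = leads n L' q (2 * n)) \<and>
     (\<forall>t. Suc t < length (hist (L' q)) \<longrightarrow> \<not> leads n L' q t \<longrightarrow> hist (L' q) ! Suc t = 0)"
  proof (cases "q = p")
    case True
    show ?thesis unfolding True L'_simps(1)
      using leads_move[OF mv wf[OF p], of "leads n L' p"] old dominates_leads unfolding True by blast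
  qed (use old in \<open>auto simp: L'_simps\<close>)
qed

lemma inv_captured': "inv_captured L' M'"
  unfolding inv_captured_def
proof
  fix q assume q: "q \<in> {1..n}"
  have old: "\<And>h z c ov y. L q = Capturing h z c ov \<Longrightarrow> y \<in> {1..<z} \<Longrightarrow> length h \<in> set (fst (M' (f q y)))"
    "\<And>t r. Suc t < length (hist (L q)) \<Longrightarrow> leads n L' q t \<Longrightarrow> r \<in> {1..m} \<Longrightarrow> Suc t \<in> set (fst (M' r))"
    using inv q leads_L'[OF q] seen_of_length[OF q] captured_mono
    unfolding invariant_def inv_captured_def by metis+
  show "(\<forall>h z c ov. L' q = Capturing h z c ov \<longrightarrow> (\<forall>y\<in>{1..<z}. length h \<in> set (fst (M' (f q y))))) \<and>
     (\<forall>t. Suc t < length (hist (L' q)) \<longrightarrow> leads n L' q t \<longrightarrow> (\<forall>r\<in>{1..m}. Suc t \<in> set (fst (M' r))))"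
  proof (cases "q = p")
    case True
    have "(\<forall>h z c ov. s' = Capturing h z c ov \<longrightarrow> (\<forall>y\<in>{1..<z}. length h \<in> set (fst (M' (f p y))))) \<and>
      (\<forall>t. Suc t < length (hist s') \<longrightarrow> leads n L' p t \<longrightarrow> (\<forall>y\<in>{1..m}. Suc t \<in> set (fst (M' (f p y)))))"
    proof (rule captured_move[OF mv wf[OF p]])
      fix h t assume "L p = Waiting h x" "length h = Suc t" "n \<le> stage_posts t (M (f p x))"
      thus "dominates h (M (f p x)) = leads n L' p t" by (rule dominates_leads)
    next
      fix h c ov assume "length h \<in> set (fst v')"
      thus "length h \<in> set (fst (M' (f p x)))" by (simp add: M'_def)
    next
      fix t y assume "Suc t < length (hist (L p))" "leads n L' p t" "y \<in> {1..m}"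
      thus "Suc t \<in> set (fst (M' (f p y)))" using old(2) f_in[OF p] True by blast
    qed (use old(1) True in blast)
    moreover have "\<exists>y\<in>{1..m}. f p y = r" if "r \<in> {1..m}" for r using f_surj[OF p that] by metis
    ultimately show ?thesis unfolding True L'_simps(1) by metis
  qed (use old in \<open>auto simp: L'_simps\<close>)
qed

lemma invariant_move: "invariant L' M'"
  using wf' inv_posts' inv_seen' inv_leads' inv_captured' inv_total' by (simp add: invariant_def)

lemmas invariant_step = invariant_move[unfolded L'_def M'_def]

end

end

subsection \<open>Termination\<close>

text \<open>The lexicographic order of history length, phase (posting, waiting, then capturing or
  finished) and register name, coded as a number; \<open>Suc m\<close> exceeds every name.\<close>

fun progress :: "nat \<Rightarrow> state \<Rightarrow> nat" where
  "progress m (Posting h x ov) = 3 * Suc m * length h + x"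
| "progress m (Waiting h x) = 3 * Suc m * length h + Suc m + x"
| "progress m (Capturing h x c ov) = 3 * Suc m * length h + 2 * Suc m + x"
| "progress m (Finished h b) = 3 * Suc m * length h + 2 * Suc m"

text \<open>The number of own steps before a successful \<open>CompareSwap\<close> if the memory stays \<open>V\<close>.\<close>

fun delay :: "(nat \<Rightarrow> register) \<Rightarrow> state \<Rightarrow> nat" where
  "delay V (Posting h x ov) = (case ov of None \<Rightarrow> 1 | Some u \<Rightarrow> if u = V x then 0 else 2)"
| "delay V (Capturing h x c ov) = (case ov of None \<Rightarrow> 1 | Some u \<Rightarrow> if u = V x then 0 else 2)"
| "delay V s = 0"

lemma delay_le: "delay V s \<le> 2"
  by (cases s) (auto split: option.splits)

lemma progress_le: "well_formed n m s \<Longrightarrow> progress m s \<le> 3 * Suc m * (2 * n + 2)"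
proof -
  assume s: "well_formed n m s"
  have "3 * Suc m * length (hist s) \<le> 3 * Suc m * (2 * n + 1)"
    using s by (intro mult_le_mono2) (cases s; auto)
  thus ?thesis using s by (cases s) auto
qed

text \<open>Without progress, a read stores the present value and lowers the delay from
  \<open>1\<close> to \<open>0\<close>, a failed \<open>CompareSwap\<close> lowers it from
  \<open>2\<close> to \<open>1\<close>, and a process still lacking posts does nothing.\<close>

lemma progress_move:
  assumes "move n m s x (V x) s' v'" and "well_formed n m s"
  shows "progress m s < progress m s' \<or>
    progress m s = progress m s' \<and> v' = V x \<and> (delay V s' < delay V s \<or>
      s' = s \<and> (\<exists>h. s = Waiting h x \<and> stage_posts (length h - 1) (V x) < n))"
  using assms by (cases rule: move.cases) (auto simp: after_defs)

context permuted
begin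

text \<open>Progress of one process may change the memory and so raise the delays of others. The
  second sum is at most \<open>2 * n\<close>, so the factor \<open>Suc (2 * n)\<close> outweighs
  this.\<close>

definition potential :: "(state, register) config \<Rightarrow> nat" where
  "potential C = Suc (2 * n) * (\<Sum>p\<in>{1..n}. progress m (loc C p)) +
     (\<Sum>p\<in>{1..n}. 2 - delay (\<lambda>x. mem C (f p x)) (loc C p))"

lemma potential_le:
  assumes "\<And>p. p \<in> {1..n} \<Longrightarrow> well_formed n m (loc C p)"
  shows "potential C \<le> Suc (2 * n) * (n * (3 * Suc m * (2 * n + 2))) + n * 2"
proof -
  have "(\<Sum>p\<in>{1..n}. progress m (loc C p)) \<le> (\<Sum>p\<in>{1..n}. 3 * Suc m * (2 * n + 2))"
    by (intro sum_mono progress_le assms)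
  moreover have "(\<Sum>p\<in>{1..n}. 2 - delay (\<lambda>x. mem C (f p x)) (loc C p)) \<le> (\<Sum>p\<in>{1..n}. 2)"
    by (intro sum_mono) auto
  ultimately show ?thesis unfolding potential_def sum_constant card_atLeastAtMost
    by (intro add_mono mult_le_mono2) auto
qed

lemma potential_move:
  assumes p: "p \<in> {1..n}" and wf: "well_formed n m (loc C p)"
    and mv: "move n m (loc C p) x (mem C (f p x)) s' v'"
    and C': "C' = \<lparr>loc = (loc C)(p := s'), mem = (mem C)(f p x := v')\<rparr>"
  shows "potential C < potential C' \<or>
    C' = C \<and> (\<exists>h. loc C p = Waiting h x \<and> stage_posts (length h - 1) (mem C (f p x)) < n)"
proof -
  let ?V = "\<lambda>C q x. mem C (f q x)"
  let ?d = "\<lambda>C q. 2 - delay (?V C q) (loc C q)"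
  have split: "(\<Sum>q\<in>{1..n}. g q) = g p + (\<Sum>q\<in>{1..n} - {p}. g q)" for g :: "nat \<Rightarrow> nat"
    using p by (simp add: sum.remove)
  have rest: "(\<Sum>q\<in>{1..n} - {p}. progress m (loc C' q)) = (\<Sum>q\<in>{1..n} - {p}. progress m (loc C q))"
    by (rule sum.cong) (auto simp: C')
  consider "progress m (loc C p) < progress m s'"
    | "progress m (loc C p) = progress m s'" "v' = mem C (f p x)" "delay (?V C p) s' < delay (?V C p) (loc C p)"
    | "v' = mem C (f p x)" "s' = loc C p" "\<exists>h. loc C p = Waiting h x \<and> stage_posts (length h - 1) (mem C (f p x)) < n"
    using progress_move[of n m "loc C p" x "?V C p" s' v'] mv wf by auto
  thus ?thesis
  proof cases
    case 1
    hence "Suc (\<Sum>q\<in>{1..n}. progress m (loc C q)) \<le> (\<Sum>q\<in>{1..n}. progress m (loc C' q))"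
      using rest split[of "\<lambda>q. progress m (loc C q)"] split[of "\<lambda>q. progress m (loc C' q)"]
      by (simp add: C')
    from mult_le_mono2[OF this, of "Suc (2 * n)"]
    have "Suc (2 * n) * (\<Sum>q\<in>{1..n}. progress m (loc C q)) + Suc (2 * n)
        \<le> Suc (2 * n) * (\<Sum>q\<in>{1..n}. progress m (loc C' q))" by simp
    moreover have "(\<Sum>q\<in>{1..n}. ?d C q) \<le> (\<Sum>q\<in>{1..n}. 2)" by (intro sum_mono) auto
    ultimately show ?thesis by (simp add: potential_def)
  next
    case 2
    have M: "mem C' = mem C" using 2 by (auto simp: C')
    have "(\<Sum>q\<in>{1..n} - {p}. ?d C' q) = (\<Sum>q\<in>{1..n} - {p}. ?d C q)"
      by (rule sum.cong) (auto simp: M, simp add: C')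
    moreover have "?d C' p > ?d C p" unfolding M using 2 delay_le[of "?V C p" "loc C p"] by (simp add: C')
    ultimately have "(\<Sum>q\<in>{1..n}. ?d C q) < (\<Sum>q\<in>{1..n}. ?d C' q)"
      using split[of "?d C"] split[of "?d C'"] by simp
    moreover have "(\<Sum>q\<in>{1..n}. progress m (loc C q)) = (\<Sum>q\<in>{1..n}. progress m (loc C' q))"
      using 2 rest split[of "\<lambda>q. progress m (loc C q)"] split[of "\<lambda>q. progress m (loc C' q)"]
      by (simp add: C')
    ultimately show ?thesis by (simp add: potential_def)
  next
    case 3
    hence "C' = C" by (simp add: C')
    thus ?thesis using 3 by blast
  qed
qed

text \<open>Consider a waiting process with the shortest history. All others are finished or wait in
  the same or a later stage, so they have posted for its stage everywhere, and its register already
  has the \<open>n\<close> posts.\<close>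

lemma not_all_waiting:
  assumes inv: "invariant L M" and p: "p \<in> {1..n}" "L p = Waiting h x"
    and stuck: "\<And>q h x. q \<in> {1..n} \<Longrightarrow> L q = Waiting h x \<Longrightarrow> stage_posts (length h - 1) (M (f q x)) < n"
    and waiting: "\<And>q. q \<in> {1..n} \<Longrightarrow> (\<exists>h b. L q = Finished h b) \<or> (\<exists>h x. L q = Waiting h x)"
  shows False
proof -
  let ?W = "\<lambda>q. q \<in> {1..n} \<and> (\<exists>h x. L q = Waiting h x)"
  have "?W p" using p by blast
  from ex_has_least_nat[of ?W, OF this, of "\<lambda>q. length (hist (L q))"]
  obtain q where q: "?W q" and least: "\<And>r. ?W r \<Longrightarrow> length (hist (L q)) \<le> length (hist (L r))" by blast
  obtain h x where h: "L q = Waiting h x" using q by blast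
  have wf: "well_formed n m (L r)" if "r \<in> {1..n}" for r using inv that by (simp add: invariant_def)
  have x: "x \<in> {1..m}" and len: "1 \<le> length h" "length h \<le> Suc (2 * n)" using wf[of q] q h by auto
  have "posted (L r) (length h - 1) z" if r: "r \<in> {1..n}" for r z
  proof (cases "\<exists>h b. L r = Finished h b")
    case True thus ?thesis using wf[OF r] len by auto
  next
    case False
    then obtain h' x' where h': "L r = Waiting h' x'" using waiting[OF r] by blast
    hence "length h \<le> length h'" using least[of r] r h by auto
    thus ?thesis using h' len by simp
  qed
  hence "n \<le> stage_posts (length h - 1) (M (f q x))"
    using inv f_in[of q x] q x by (intro stage_posts_full[of L M]) (auto simp: invariant_def)
  thus False using stuck[OF _ h] q by force
qed

section \<open>Executions: invariant, termination and outcome\<close>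

context
  fixes \<sigma>
  assumes exec: "execution n m (election_algorithm n m) f \<sigma>"
begin

abbreviation "conf \<equiv> run (election_algorithm n m) f \<sigma>"

lemma sched: "\<sigma> k \<in> {1..n}"
  using exec by (simp add: execution_def)

lemma conf_step:
  assumes wf: "well_formed n m (loc (conf k) (\<sigma> k))"
  obtains (finished) h b where "loc (conf k) (\<sigma> k) = Finished h b" and "conf (Suc k) = conf k"
  | (move) x s' v' where "x \<in> {1..m}"
      and "move n m (loc (conf k) (\<sigma> k)) x (mem (conf k) (f (\<sigma> k) x)) s' v'"
      and "conf (Suc k) =
        \<lparr>loc = (loc (conf k))(\<sigma> k := s'), mem = (mem (conf k))(f (\<sigma> k) x := v')\<rparr>"
proof (cases "target (election_code n m (loc (conf k) (\<sigma> k)))")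
  case None
  moreover have "conf (Suc k) = conf k"
    using None by (simp add: step_eq election_algorithm_code[OF wf])
  ultimately show ?thesis using finished unfolding target_code_finished by blast
next
  case (Some x)
  show ?thesis
    by (rule move[OF target_code_in[OF wf Some] move_code[OF Some]])
      (simp add: step_eq election_algorithm_code[OF wf] Some)
qed

lemma conf_invariant: "invariant (loc (conf k)) (mem (conf k))"
proof (induction k)
  case 0
  show ?case using invariant_init by (simp add: init_config_def election_algorithm_def)
next
  case (Suc k)
  hence "well_formed n m (loc (conf k) (\<sigma> k))" using sched by (simp add: invariant_def)
  thus ?case
  proof (cases rule: conf_step)
    case finished
    thus ?thesis using Suc by simp
  next
    case (move x s' v')
    show ?thesis unfolding move(3) config.simps by (rule invariant_step[OF Suc sched move(1,2)])
  qed
qed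

lemma conf_well_formed: "p \<in> {1..n} \<Longrightarrow> well_formed n m (loc (conf k) p)"
  using conf_invariant[of k] by (simp add: invariant_def)

lemma conf_potential:
  "potential (conf k) < potential (conf (Suc k)) \<or> conf (Suc k) = conf k \<and>
     ((\<exists>h b. loc (conf k) (\<sigma> k) = Finished h b) \<or>
      (\<exists>h x. loc (conf k) (\<sigma> k) = Waiting h x \<and>
        stage_posts (length h - 1) (mem (conf k) (f (\<sigma> k) x)) < n))"
proof -
  have wf: "well_formed n m (loc (conf k) (\<sigma> k))" by (rule conf_well_formed[OF sched])
  thus ?thesis
  proof (cases rule: conf_step)
    case (move x s' v')
    thus ?thesis using potential_move[OF sched wf move(2,3)] by blast
  qed auto
qed

lemma conf_returned:
  assumes "p \<in> {1..n}"
  shows "returned (election_algorithm n m) p r (conf k) \<longleftrightarrow>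
     (\<exists>h b. loc (conf k) p = Finished h b \<and> r = (if b then Leader else NotLeader))"
  unfolding returned_def election_algorithm_code[OF conf_well_formed[OF assms]]
  by (cases "(n, m, loc (conf k) p)" rule: election_code.cases) auto

text \<open>The potential is bounded and grows with every effective step, so the configuration is
  constant from a time \<open>K\<close> of maximal potential on. Fairness makes each unfinished
  process take a void step after \<open>K\<close>, so it waits for missing posts; not all unfinished
  processes can do so.\<close>

lemma eventually_finished:
  "\<exists>K. (\<forall>p\<in>{1..n}. \<exists>h b. loc (conf K) p = Finished h b) \<and> (\<forall>k\<ge>K. conf k = conf K)"
proof -
  let ?B = "Suc (2 * n) * (n * (3 * Suc m * (2 * n + 2))) + n * 2"
  have "\<forall>k. True \<longrightarrow> potential (conf k) < Suc ?B"
    using potential_le conf_well_formed by (simp add: less_Suc_eq_le del: mult_Suc)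
  from ex_has_greatest_nat[of "\<lambda>k. True", OF TrueI this]
  obtain K where K: "\<And>k. potential (conf k) \<le> potential (conf K)" by blast
  have const: "conf k = conf K" if "K \<le> k" for k
    using that
  proof (induction k rule: dec_induct)
    case (step k)
    thus ?case using conf_potential[of k] K[of "Suc k"] by auto
  qed simp
  have idle: "(\<exists>h b. loc (conf K) p = Finished h b) \<or>
      (\<exists>h x. loc (conf K) p = Waiting h x \<and> stage_posts (length h - 1) (mem (conf K) (f p x)) < n)"
    if p: "p \<in> {1..n}" for p
  proof (cases "\<exists>r. returned (election_algorithm n m) p r (conf K)")
    case True thus ?thesis unfolding conf_returned[OF p] by blast
  next
    case False
    then obtain j where j: "j \<ge> K" "\<sigma> j = p" using exec p unfolding execution_def by blast
    have "potential (conf (Suc j)) = potential (conf j)" using const[of j] const[of "Suc j"] j by simp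
    thus ?thesis using conf_potential[of j] j const[OF j(1)] by auto
  qed
  have "\<exists>h b. loc (conf K) p = Finished h b" if p: "p \<in> {1..n}" for p
  proof (rule ccontr)
    assume "\<not> ?thesis"
    then obtain h x where "loc (conf K) p = Waiting h x" using idle[OF p] by blast
    from conf_invariant p this show False
    proof (rule not_all_waiting)
      fix q h x assume "q \<in> {1..n}" "loc (conf K) q = Waiting h x"
      thus "stage_posts (length h - 1) (mem (conf K) (f q x)) < n" using idle[of q] by auto
    qed (use idle in blast)
  qed
  thus ?thesis using const by blast
qed

lemma elects:
  "\<forall>p\<in>{1..n}. \<exists>k r. returned (election_algorithm n m) p r (conf k)"
  "1 \<le> card (elected n (election_algorithm n m) f \<sigma>)"
  "card (elected n (election_algorithm n m) f \<sigma>) \<le> gcd n m"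
proof -
  obtain K where fin: "\<And>p. p \<in> {1..n} \<Longrightarrow> \<exists>h b. loc (conf K) p = Finished h b"
    and const: "\<And>k. K \<le> k \<Longrightarrow> conf k = conf K" using eventually_finished by blast
  show "\<forall>p\<in>{1..n}. \<exists>k r. returned (election_algorithm n m) p r (conf k)"
    using fin by (metis conf_returned)
  define L where "L = loc (conf K)"
  define M where "M = mem (conf K)"
  have inv: "invariant L M" unfolding L_def M_def by (rule conf_invariant)
  have Lp: "\<exists>h b. L p = Finished h b \<and> length h = Suc (2 * n) \<and> h ! 0 = 0 \<and> b = leads n L p (2 * n)"
    if p: "p \<in> {1..n}" for p
  proof -
    obtain h b where h: "L p = Finished h b" using fin[OF p] unfolding L_def by blast
    moreover have "well_formed n m (L p)" using inv p by (simp add: invariant_def)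
    moreover have "b = leads n L p (2 * n)"
      using inv p h unfolding invariant_def inv_leads_def by blast
    ultimately show ?thesis by auto
  qed
  have "returned (election_algorithm n m) p Leader (conf k) \<Longrightarrow> leads n L p (2 * n)"
    if p: "p \<in> {1..n}" for p k
  proof -
    assume "returned (election_algorithm n m) p Leader (conf k)"
    hence "returned (election_algorithm n m) p Leader (conf (max k K))" by (rule returned_mono) simp
    hence "returned (election_algorithm n m) p Leader (conf K)" using const[of "max k K"] by simp
    then obtain h where "L p = Finished h True"
      unfolding conf_returned[OF p] L_def by (metis outcome.distinct(1))
    thus ?thesis using Lp[OF p] by (metis state.inject(4))
  qed
  moreover have "returned (election_algorithm n m) p Leader (conf K)"
    if p: "p \<in> {1..n}" and lead: "leads n L p (2 * n)" for p
  proof -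
    obtain h where "L p = Finished h True" using Lp[OF p] lead by metis
    thus ?thesis unfolding conf_returned[OF p] L_def by (auto intro: exI[of _ True])
  qed
  ultimately have E: "elected n (election_algorithm n m) f \<sigma> =
      {p \<in> {1..n}. \<forall>q\<in>{1..n}. share (L q) (2 * n) \<le> share (L p) (2 * n)}"
    unfolding elected_def leads_def by blast
  have zero: "share (L p) 0 = 0" if "p \<in> {1..n}" for p using Lp[OF that] by auto
  have others: "share (L p) (Suc t) = 0"
    if "p \<in> {1..n}" "t < 2 * n" "\<not> (\<forall>q\<in>{1..n}. share (L q) t \<le> share (L p) t)" for p t
  proof -
    have t: "Suc t < length (hist (L p))" using Lp[OF that(1)] that(2) by auto
    hence "hist (L p) ! Suc t = 0"
      using inv that(1,3) unfolding invariant_def inv_leads_def leads_def by blast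
    thus ?thesis using t by (simp add: share_hist)
  qed
  have total: "(\<Sum>p\<in>{1..n}. share (L p) (Suc t)) = (if even t then m else n)" if t: "t < 2 * n" for t
  proof -
    \<comment> \<open>A process of maximal share leads stage \<open>t\<close>, and its complete
      history shows that all registers were captured in the next stage.\<close>
    have "Max ((\<lambda>q. share (L q) t) ` {1..n}) \<in> (\<lambda>q. share (L q) t) ` {1..n}"
      using n by (intro Max_in) auto
    then obtain p where p: "p \<in> {1..n}" "share (L p) t = Max ((\<lambda>q. share (L q) t) ` {1..n})" by auto
    hence "leads n L p t" unfolding leads_def by auto
    moreover have "Suc t < length (hist (L p))" using Lp[OF p(1)] t by auto
    ultimately have "{r \<in> {1..m}. Suc t \<in> set (fst (M r))} = {1..m}"
      using inv p(1) unfolding invariant_def inv_captured_def by blast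
    hence "(\<Sum>p\<in>{1..n}. share (L p) (Suc t)) = (\<Sum>r\<in>{1..m}. true_weight n f (Suc t) r)"
      using inv unfolding invariant_def inv_total_def by (metis le_add1 plus_1_eq_Suc)
    thus ?thesis unfolding sum_true_weight by simp
  qed
  show "1 \<le> card (elected n (election_algorithm n m) f \<sigma>)"
    "card (elected n (election_algorithm n m) f \<sigma>) \<le> gcd n m"
    unfolding E using leader_sets_bound[of n m "\<lambda>p. share (L p)", OF n m zero others total] by blast+
qed

end

end

section \<open>Solvability and the equivalence\<close>

lemma election_algorithm_solves:
  assumes "n > 0" and "m > 0" and "gcd n m \<le> d"
  shows "solves_election n m d (election_algorithm n m)"
  unfolding solves_election_def
proof (intro conjI allI impI)
  show "uses_registers m (election_algorithm n m)"
    unfolding uses_registers_def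
  proof
    fix s
    show "case code (election_algorithm n m) s of Return r \<Rightarrow> True | Read x g \<Rightarrow> x \<in> {1..m}
        | Write x v t \<Rightarrow> x \<in> {1..m} | CompareSwap x old new g \<Rightarrow> x \<in> {1..m}"
      by (cases "election_code n m s") (auto simp: election_algorithm_def)
  qed
next
  fix f \<sigma> assume ex: "execution n m (election_algorithm n m) f \<sigma>"
  then interpret permuted n m f
    using assms by unfold_locales (auto simp: execution_def)
  show "\<forall>p\<in>{1..n}. \<exists>k r. returned (election_algorithm n m) p r (run (election_algorithm n m) f \<sigma> k)"
    "1 \<le> card (elected n (election_algorithm n m) f \<sigma>)"
    "card (elected n (election_algorithm n m) f \<sigma>) \<le> d"
    using elects[OF ex] assms(3) by auto
qed

theorem theorem7:
  fixes n m d :: nat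
  assumes "n \<ge> 2" and "m \<ge> 1" and "d \<in> {1..n - 1}"
  shows "(\<exists>A :: ('s::infinite, 'v::infinite) algorithm. solves_election n m d A) \<longleftrightarrow> gcd n m \<le> d"
proof
  assume "\<exists>A :: ('s, 'v) algorithm. solves_election n m d A"
  thus "gcd n m \<le> d" using election_impossible assms(1) by fastforce
next
  assume "gcd n m \<le> d"
  hence "solves_election n m d (election_algorithm n m)"
    using assms(1,2) by (intro election_algorithm_solves) auto
  moreover obtain i :: "state \<Rightarrow> 's" and j :: "register \<Rightarrow> 'v" where "inj i" "inj j"
    using ex_inj_infinite by metis
  ultimately show "\<exists>A :: ('s, 'v) algorithm. solves_election n m d A"
    using lift_solves by blast
qed

end
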